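(* Let $n>1$ be an integer with $n\equiv 1\pmod 4$. Then $$\sum_{k=0}^{(n-1)/2} [4k+1]\,\frac{(q;q^2)_k^3}{(q^2;q^2)_k^3}\,q^{k(n^2-2nk-n-2)/4}\equiv 0 \pmod{\Phi_n(q)^2}.$$
   Context: Here $q$ is an indeterminate. For $m\ge 1$, $[m]=[m]_q=\frac{1-q^m}{1-q}$. For $N\ge 0$, $(a;q)_0=1$ and $(a;q)_N=\prod_{j=0}^{N-1}(1-aq^j)$; thus $(q;q^2)_k=\prod_{j=0}^{k-1}(1-q^{2j+1})$ and $(q^2;q^2)_k=\prod_{j=0}^{k-1}(1-q^{2j+2})$. $\Phi_n(q)=\prod_{1\le j\le n,\ \gcd(j,n)=1}(q-\zeta^j)$, with $\zeta$ a primitive $n$-th root of unity, is the $n$-th cyclotomic polynomial. Congruences of rational functions are understood in the reduced-denominator sense: if $F(q)=P(q)/Q(q)$ with $P,Q\in\mathbb{Q}[q]$, $\gcd(P,Q)=1$, and $Q$ is relatively prime to $M(q)$, then $F(q)\equiv 0\pmod{M(q)}$ means that $M(q)$ divides $P(q)$ in $\mathbb{Q}[q]$. (The congruence thus includes the assertion that the reduced denominator is relatively prime to the modulus.) *)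

theory Defs
  imports
    "HOL-Computational_Algebra.Computational_Algebra"
    "HOL-Number_Theory.Cong"
begin

definition qvar :: "rat poly fract" where
  "qvar = Fract [:0, 1:] 1"

definition qint :: "'a::field \<Rightarrow> nat \<Rightarrow> 'a" where
  "qint q m = (1 - q ^ m) / (1 - q)"

definition qpoch :: "'a::comm_ring_1 \<Rightarrow> 'a \<Rightarrow> nat \<Rightarrow> 'a" where
  "qpoch a q N = (\<Prod>j<N. 1 - a * q ^ j)"

definition cyclotomic_complex :: "nat \<Rightarrow> complex poly" where
  "cyclotomic_complex n =
     (\<Prod>j | j \<in> {1..n} \<and> coprime j n. [:- (cis (2 * pi / real n) ^ j), 1:])"

lemma of_rat_poly_add: "map_poly of_rat (p + q) = (map_poly of_rat p + map_poly of_rat q :: 'a::field_char_0 poly)"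
  by (rule poly_eqI) (simp add: coeff_map_poly of_rat_add)

lemma of_rat_poly_mult: "map_poly of_rat (p * q) = (map_poly of_rat p * map_poly of_rat q :: 'a::field_char_0 poly)"
  by (rule poly_eqI) (simp add: coeff_map_poly coeff_mult of_rat_sum of_rat_mult)

lemma of_rat_poly_prod: "map_poly of_rat (\<Prod>x\<in>A. f x) = (\<Prod>x\<in>A. map_poly of_rat (f x) :: 'a::field_char_0 poly)"
  by (induction A rule: infinite_finite_induct) (simp_all add: of_rat_poly_mult)

lemma prod_roots_of_unity: assumes "n > 0"
  shows "(\<Prod>k=1..n. [:- (cis (2 * pi / real n) ^ k), 1:]) = monom 1 n - (1 :: complex poly)"
proof -
  let ?p = "monom 1 n - 1 :: complex poly"
  have deg: "degree ?p = n"
    using assms degree_add_eq_left[of "- 1" "monom 1 n :: complex poly"] by (simp add: degree_monom_eq)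
  have lc: "lead_coeff ?p = 1" using assms deg by simp
  have roots: "poly ?p z = 0 \<longleftrightarrow> z ^ n = 1" for z by (simp add: poly_monom)
  have "rsquarefree ?p"
    unfolding rsquarefree_roots using assms
    by (auto simp: poly_monom pderiv_diff pderiv_monom power_0_left)
  from complex_poly_decompose_rsquarefree[OF this]
  have "(\<Prod>z | z ^ n = 1. [:- z, 1:]) = ?p" by (simp only: lc roots smult_1_left)
  moreover have "bij_betw (\<lambda>k. cis (2 * pi / real n) ^ k) {1..n} {z. z ^ n = 1}"
  proof -
    have b: "bij_betw (\<lambda>k. cis (2 * pi / real n) ^ k) {..<n} {z. z ^ n = 1}"
      using bij_betw_roots_unity[OF assms] by (simp add: DeMoivre mult.commute divide_simps)
    have e: "cis (2 * pi / real n) ^ n = 1" using assms by (simp add: DeMoivre)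
    have "bij_betw (\<lambda>k. if k = n then 0 else k) {1..n} {..<n}"
      using assms by (intro bij_betwI[where g = "\<lambda>k. if k = 0 then n else k"]) auto
    from bij_betw_trans[OF this b] show ?thesis
      by (rule bij_betw_cong[THEN iffD1, rotated]) (auto simp: e)
  qed
  ultimately show ?thesis
    using prod.reindex_bij_betw[of "\<lambda>k. cis (2 * pi / real n) ^ k" "{1..n}" "{z. z ^ n = 1}" "\<lambda>z. [:- z, 1:]"] by simp
qed

lemma prod_cyclotomic_complex: assumes "n > 0"
  shows "(\<Prod>d | d dvd n. cyclotomic_complex d) = monom 1 n - 1"
proof -
  have "(\<Prod>d | d dvd n. cyclotomic_complex d) =
    (\<Prod>(d,j)\<in>(SIGMA d:{d. d dvd n}. {j. j \<in> {1..d} \<and> coprime j d}). [:- (cis (2 * pi / real d) ^ j), 1:])"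
    unfolding cyclotomic_complex_def using assms by (subst prod.Sigma) auto
  also have "\<dots> = (\<Prod>k=1..n. [:- (cis (2 * pi / real n) ^ k), 1:])"
  proof (rule prod.reindex_bij_witness[of _ "\<lambda>k. (n div gcd k n, k div gcd k n)" "\<lambda>(d,j). j * (n div d)"], goal_cases)
    case (1 a)
    then obtain d j m where a: "a = (d,j)" "n = d * m" "1 \<le> j" "j \<le> d" "coprime j d" by (auto simp: dvd_def)
    then have "m > 0" "d > 0" using assms by auto
    moreover have "gcd (j * m) n = m"
      using a gcd_mult_distrib_nat[of m j d] by (simp add: mult.commute)
    ultimately have "gcd (j * m) n = m" "m > 0" "d > 0" by auto
    then show ?case using a by auto
  next
    case (2 a)
    then obtain d j m where a: "a = (d,j)" "n = d * m" "1 \<le> j" "j \<le> d" "coprime j d" by (auto simp: dvd_def)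
    then have "m > 0" "d > 0" using assms by auto
    then show ?case using a by auto
  next
    case (3 k)
    have "k div gcd k n * (n div (n div gcd k n)) = k div gcd k n * gcd k n"
      using assms by (subst div_div_eq_right) auto
    then show ?case by simp
  next
    case (4 k)
    have "gcd k n > 0" using assms by simp
    moreover from this obtain k' n' where "k = k' * gcd k n" "n = n' * gcd k n" "coprime k' n'"
      using gcd_coprime_exists[of k n] by auto
    ultimately obtain g k' n' where g: "g = gcd k n" "g > 0" "k = k' * g" "n = n' * g" "coprime k' n'"
      by blast
    have "k div gcd k n = k'" "n div gcd k n = n'"
      using g(2-4) unfolding g(1)[symmetric] by auto
    moreover have "1 \<le> k'" "k' \<le> n'" "n' dvd n" using 4 g(2-4) by (auto simp: Suc_le_eq)
    ultimately show ?case using g(5) by simp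
  next
    case (5 a)
    then obtain d j m where a: "a = (d,j)" "n = d * m" "1 \<le> j" "j \<le> d" "coprime j d" by (auto simp: dvd_def)
    then have "m > 0" "d > 0" using assms by auto
    then show ?case using a by (simp add: DeMoivre)
  qed
  finally show ?thesis using prod_roots_of_unity[OF assms] by simp
qed

lemma cyclotomic_ex1: "\<exists>!p :: rat poly. map_poly of_rat p = cyclotomic_complex n"
proof (rule ex_ex1I)
  show "\<exists>p. map_poly of_rat p = cyclotomic_complex n"
  proof (induction n rule: less_induct)
    case (less n)
    show ?case
    proof (cases "n = 0")
      case True
      then show ?thesis by (auto simp: cyclotomic_complex_def intro: exI[of _ 1])
    next
      case False
      define D where "D = {d. d dvd n \<and> d < n}"
      have fin: "finite D" unfolding D_def by auto
      have Dn: "{d. d dvd n} = insert n D" "n \<notin> D" using False by (auto simp: D_def dvd_imp_le le_neq_implies_less)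
      obtain f where f: "map_poly of_rat (f d) = cyclotomic_complex d" if "d \<in> D" for d
        using less unfolding D_def by (metis (mono_tags, lifting) mem_Collect_eq)
      define b :: "rat poly" where "b = (\<Prod>d\<in>D. f d)"
      define a :: "rat poly" where "a = monom 1 n - 1"
      let ?h = "map_poly of_rat :: rat poly \<Rightarrow> complex poly"
      have hb: "?h b = (\<Prod>d\<in>D. cyclotomic_complex d)" unfolding b_def by (simp add: of_rat_poly_prod f)
      have ha: "?h a = monom 1 n - 1" unfolding a_def
        by (rule poly_eqI) (simp add: coeff_map_poly of_rat_diff)
      have eq: "?h a = cyclotomic_complex n * ?h b"
        using prod_cyclotomic_complex[of n] False fin Dn by (simp add: ha hb)
      have "cyclotomic_complex d \<noteq> 0" for d by (simp add: cyclotomic_complex_def)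
      then have "?h b \<noteq> 0" using fin by (simp add: hb)
      then have b0: "b \<noteq> 0" by auto
      have degh: "degree (?h p) = degree p" for p by (rule degree_map_poly) simp
      have "?h a = ?h (a div b) * ?h b + ?h (a mod b)"
        by (simp flip: of_rat_poly_mult of_rat_poly_add)
      then have m: "?h (a mod b) = (cyclotomic_complex n - ?h (a div b)) * ?h b"
        using eq by (simp add: algebra_simps)
      have "cyclotomic_complex n - ?h (a div b) = 0"
      proof (rule ccontr)
        assume nz: "cyclotomic_complex n - ?h (a div b) \<noteq> 0"
        then have "degree (a mod b) = degree (cyclotomic_complex n - ?h (a div b)) + degree b"
          using degree_mult_eq[OF nz \<open>?h b \<noteq> 0\<close>] m degh by metis
        moreover have "a mod b \<noteq> 0" using m nz \<open>?h b \<noteq> 0\<close> by auto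
        ultimately show False using degree_mod_less[OF b0, of a] by auto
      qed
      then show ?thesis by (intro exI[of _ "a div b"]) simp
    qed
  qed
next
  fix p q :: "rat poly"
  assume "map_poly of_rat p = cyclotomic_complex n" "map_poly of_rat q = cyclotomic_complex n"
  then have "coeff (map_poly of_rat p :: complex poly) i = coeff (map_poly of_rat q) i" for i by simp
  then show "p = q" by (intro poly_eqI) (simp add: coeff_map_poly)
qed

definition cyclotomic :: "nat \<Rightarrow> rat poly" where
  "cyclotomic n = (THE p. map_poly of_rat p = cyclotomic_complex n)"

lemma of_rat_cyclotomic: "map_poly of_rat (cyclotomic n) = cyclotomic_complex n"
  unfolding cyclotomic_def by (rule theI') (rule cyclotomic_ex1)

text \<open>
  The congruence \<open>F \<equiv> 0 (mod M)\<close> for a rational function \<open>F\<close>: it includes the assertion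
  that the denominator of \<open>F\<close> in lowest terms is relatively prime to \<open>M\<close>. The pair
  \<open>P\<close>, \<open>Q\<close> is determined by \<open>F\<close> up to a common nonzero constant factor.
\<close>

definition ratfun_cong_0 :: "rat poly fract \<Rightarrow> rat poly \<Rightarrow> bool" where
  "ratfun_cong_0 F M \<longleftrightarrow>
     (\<exists>P Q. Q \<noteq> 0 \<and> F = Fract P Q \<and> coprime P Q \<and> coprime Q M \<and> M dvd P)"

text \<open>The exponent of \<open>q\<close> in the theorem is an integer, so that \<open>div\<close> is exact division there.\<close>

lemma four_dvd_exponent:
  fixes n k :: nat
  assumes "[n = 1] (mod 4)"
  shows "4 dvd int k * (int n ^ 2 - 2 * int n * int k - int n - 2)"
proof -
  obtain m where n: "n = 4 * m + 1"
    using that[of "n div 4"] assms div_mult_mod_eq[of n 4] by (simp add: cong_def)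
  have "even (int k * (int k + 1))" by simp
  then obtain l where l: "int k * (int k + 1) = 2 * l" by (elim evenE)
  have "int k * (int n ^ 2 - 2 * int n * int k - int n - 2)
    = 4 * (int k * (4 * int m ^ 2 + int m - 2 * int m * int k)) - 2 * (int k * (int k + 1))"
    unfolding n by (simp add: algebra_simps power2_eq_square)
  then show ?thesis unfolding l by simp
qed

end

theory Submission
  imports Defs "HOL-Computational_Algebra.Field_as_Ring"
begin

text \<open>
  Write \<open>n = 4m + 1\<close> and \<open>x = q\<^sup>n - 1\<close>. Modulo \<open>\<Phi>\<^sub>n(q)\<^sup>2\<close> two of the three factors \<open>(q;q\<^sup>2)\<^sub>k/(q\<^sup>2;q\<^sup>2)\<^sub>k\<close>
  may be replaced by \<open>(q\<^bsup>1+n\<^esup>, q\<^bsup>1-n\<^esup>;q\<^sup>2)\<^sub>k/(q\<^bsup>2-n\<^esup>, q\<^bsup>2+n\<^esup>;q\<^sup>2)\<^sub>k\<close>, because the change is even in the shift.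
  A terminating very-well-poised \<open>\<^sub>6\<phi>\<^sub>5\<close> sum with a further parameter \<open>d = q\<^bsup>(3 \<plusminus> n)/2\<^esup>\<close> then has
  a closed form divisible by \<open>\<Phi>\<^sub>n(q)\<^sup>2\<close>. Averaged over the two signs, the factors that involve \<open>d\<close>
  differ from the power of \<open>q\<close> in the theorem by \<open>q\<^bsup>-k(n+1)/2\<^esup> x k (2m - k)/2\<close> modulo \<open>\<Phi>\<^sub>n(q)\<^sup>2\<close>.
  This difference contributes \<open>x\<close> times a sum that vanishes modulo \<open>\<Phi>\<^sub>n(q)\<close>, since its summand changes
  sign under \<open>k \<mapsto> 2m - k\<close>.
\<close>

subsection \<open>The terminating very-well-poised sum\<close>

lemma qpoch_0 [simp]: "qpoch a q 0 = 1"
  by (simp add: qpoch_def)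

lemma qpoch_Suc: "qpoch a q (Suc N) = qpoch a q N * (1 - a * q ^ N)"
  by (simp add: qpoch_def)

lemma qpoch_shift: "qpoch a q (Suc N) = (1 - a) * qpoch (a * q) q N"
  by (simp add: qpoch_def prod.lessThan_Suc_shift mult.assoc del: prod.lessThan_Suc)

text \<open>
  The summand of the terminating very-well-poised \<open>\<^sub>6\<phi>\<^sub>5\<close> series. The terminating parameter is
  \<open>1/y\<close> with \<open>y = q\<^sup>M\<close>; its shifted factorial is multiplied by \<open>y\<^sup>k\<close>, a factor of the argument
  \<open>(a q y / (b d))\<^sup>k\<close>, so that no inverse of \<open>y\<close> occurs.
\<close>
definition vwp_term :: "'a::field \<Rightarrow> 'a \<Rightarrow> 'a \<Rightarrow> 'a \<Rightarrow> 'a \<Rightarrow> nat \<Rightarrow> 'a" where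
  "vwp_term a b d q y k =
     (1 - a * q ^ (2 * k)) * qpoch a q k * qpoch b q k * qpoch d q k * (\<Prod>j<k. y - q ^ j)
     / (qpoch q q k * qpoch (a * q / b) q k * qpoch (a * q / d) q k * qpoch (a * q * y) q k)
     * (a * q / (b * d)) ^ k"

text \<open>One inductive step of the telescoping in \<open>vwp_partial_sum\<close>, with
  \<open>Z = q ^ K\<close> and the common factor cancelled: summands on the left, certificates on
  the right.\<close>

lemma wz_identity:
  fixes a b d q y Z :: "'a::field"
  assumes "a \<noteq> 0" "b \<noteq> 0" "d \<noteq> 0" "q \<noteq> 0"
  shows "(1 - a * q^2 * Z^2) * ((q * y - 1) * Z * (1 - a * q * y / b) * (1 - a * q * y / d)
           - (1 - a * q * y / (b * d)) * (y - Z) * (1 - a * q * (q * Z) * y))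
    = (a * q * y / (b * d)) * (1 - a * (q * Z)) * (1 - b * (q * Z)) * (1 - d * (q * Z)) * (y - Z)
      - y * (1 - q * Z) * (1 - a * q / b * Z) * (1 - a * q / d * Z) * (1 - a * q * y * (q * Z))"
proof -
  \<comment> \<open>Naming the reciprocals makes the claim polynomial modulo
    \<open>b * B = 1\<close> and \<open>d * D = 1\<close>.\<close>
  define B D where "B = 1 / b" and "D = 1 / d"
  have 1: "b * B = 1" "d * D = 1" using assms by (simp_all add: B_def D_def)
  have *: "u / b = u * B" "u / d = u * D" "u / (b * d) = u * B * D" for u by (simp_all add: B_def D_def)
  show ?thesis unfolding * using 1 by algebra
qed

text \<open>
  The WZ pair for the recursion in \<open>M\<close>, that is for \<open>y \<mapsto> q y\<close>: the right-hand side is the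
  telescoping certificate, and it vanishes at \<open>y = q\<^sup>M\<close> as soon as \<open>K > M\<close>.
\<close>
lemma vwp_partial_sum:
  fixes a b d q y :: "'a::field"
  assumes nz: "a \<noteq> 0" "b \<noteq> 0" "d \<noteq> 0" "q \<noteq> 0"
    and q1: "\<And>j. q * q ^ j \<noteq> 1"
    and b1: "\<And>j. a * q / b * q ^ j \<noteq> 1"
    and d1: "\<And>j. a * q / d * q ^ j \<noteq> 1"
    and y1: "\<And>j. a * q * y * q ^ j \<noteq> 1"
  shows "(1 - a * q * y / b) * (1 - a * q * y / d) * (\<Sum>k\<le>K. vwp_term a b d q (q * y) k)
     - (1 - a * q * y) * (1 - a * q * y / (b * d)) * (\<Sum>k\<le>K. vwp_term a b d q y k)
     = (1 - a * q * y) * (a * q * y / (b * d)) * qpoch a q (Suc K) * qpoch b q (Suc K) * qpoch d q (Suc K)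
       * (\<Prod>j<K. y - q ^ j) * (a * q / (b * d)) ^ K
       / (qpoch q q K * qpoch (a * q / b) q K * qpoch (a * q / d) q K * qpoch (a * q * y) q (Suc K))"
proof (induction K)
  case 0
  have "1 - a * q * y \<noteq> 0" using y1[of 0] by simp
  then show ?case using nz
    by (simp add: vwp_term_def qpoch_Suc) (simp add: field_simps)
next
  case (Suc K)
  define Z where "Z = q ^ K"
  define P where "P = (\<Prod>j<K. y - q ^ j)"
  define r where "r = a * q / (b * d)"
  \<comment> \<open>Common factor of both summands at \<open>Suc K\<close> and of both certificates.
    It carries the longest denominators, so the cofactors depend polynomially on
    \<open>Z\<close>.\<close>
  define W where "W = qpoch a q (Suc K) * qpoch b q (Suc K) * qpoch d q (Suc K) * P * r ^ Suc K
    / (qpoch q q (Suc K) * qpoch (a * q / b) q (Suc K) * qpoch (a * q / d) q (Suc K) * qpoch (a * q * y) q (Suc (Suc K)))"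
  have r0: "r \<noteq> 0" using nz by (simp add: r_def)
  have f: "1 - q * Z \<noteq> 0" "1 - a * q / b * Z \<noteq> 0" "1 - a * q / d * Z \<noteq> 0" "1 - a * q * y * (q * Z) \<noteq> 0"
      "1 - a * q * y \<noteq> 0"
    using q1[of K] b1[of K] d1[of K] y1[of "Suc K"] y1[of 0] by (simp_all add: Z_def)
  \<comment> \<open>The summand at \<open>q * y\<close> has a denominator starting at a q^2 y; one
    extra factor turns it into that of \<open>W\<close>.\<close>
  have sh: "(1 - a * q * y) * qpoch (a * q * (q * y)) q (Suc K) = qpoch (a * q * y) q (Suc (Suc K))"
    by (subst (2) qpoch_shift) (simp add: mult_ac)
  \<comment> \<open>Splitting off \<open>j = 0\<close> and shifting the index leaves
    \<open>K\<close> factors \<open>q\<close>, whose product is \<open>Z\<close>.\<close>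
  have pr: "(\<Prod>j<Suc K. q * y - q ^ j) = (q * y - 1) * Z * P"
  proof -
    have "(\<Prod>j<Suc K. q * y - q ^ j) = (q * y - 1) * (\<Prod>j<K. q * (y - q ^ j))"
      by (simp add: prod.lessThan_Suc_shift algebra_simps del: prod.lessThan_Suc)
    then show ?thesis by (simp add: prod.distrib P_def Z_def)
  qed
  have Z2: "q ^ (2 * Suc K) = q^2 * Z^2" 
    unfolding Z_def mult_Suc_right power_add by (simp add: power_even_eq)
  have t1: "vwp_term a b d q (q * y) (Suc K) = W * ((1 - a * q^2 * Z^2) * ((q * y - 1) * Z) * (1 - a * q * y))"
    unfolding vwp_term_def pr Z2 W_def sh[symmetric] r_def[symmetric] using f(5) by (simp add: mult_ac)
  have t2: "vwp_term a b d q y (Suc K) = W * ((1 - a * q^2 * Z^2) * (y - Z) * (1 - a * q * (q * Z) * y))"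
    unfolding vwp_term_def Z2 W_def r_def[symmetric] qpoch_Suc[of "a * q * y" q "Suc K"] using f(4)
    by (simp add: P_def Z_def mult_ac)
  let ?\<kappa> = "(1 - a * q * y) * (a * q * y / (b * d))"
  have g1: "?\<kappa> * qpoch a q (Suc K) * qpoch b q (Suc K) * qpoch d q (Suc K)
       * P * r ^ K
       / (qpoch q q K * qpoch (a * q / b) q K * qpoch (a * q / d) q K * qpoch (a * q * y) q (Suc K))
     = ?\<kappa> / r * W * ((1 - q * Z) * (1 - a * q / b * Z) * (1 - a * q / d * Z) * (1 - a * q * y * (q * Z)))"
  proof -
    have e: "qpoch q q (Suc K) = qpoch q q K * (1 - q * Z)"
      "qpoch (a * q / b) q (Suc K) = qpoch (a * q / b) q K * (1 - a * q / b * Z)"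
      "qpoch (a * q / d) q (Suc K) = qpoch (a * q / d) q K * (1 - a * q / d * Z)"
      "qpoch (a * q * y) q (Suc (Suc K)) = qpoch (a * q * y) q (Suc K) * (1 - a * q * y * (q * Z))"
      by (simp_all add: qpoch_Suc Z_def)
    have gen: "k * pa * pb * pd * p * rK / (A1 * A2 * A3 * A4)
      = k / r * (pa * pb * pd * p * (r * rK) / ((A1 * e1) * (A2 * e2) * (A3 * e3) * (A4 * e4))) * (e1 * e2 * e3 * e4)"
      if "e1 \<noteq> 0" "e2 \<noteq> 0" "e3 \<noteq> 0" "e4 \<noteq> 0" for k pa pb pd p rK A1 A2 A3 A4 e1 e2 e3 e4
      using that r0 by (simp add: mult_ac)
    show ?thesis unfolding W_def e power_Suc using f(1-4) by (rule gen)
  qed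
  have g2: "?\<kappa> * qpoch a q (Suc (Suc K)) * qpoch b q (Suc (Suc K)) * qpoch d q (Suc (Suc K))
       * (\<Prod>j<Suc K. y - q ^ j) * r ^ Suc K
       / (qpoch q q (Suc K) * qpoch (a * q / b) q (Suc K) * qpoch (a * q / d) q (Suc K) * qpoch (a * q * y) q (Suc (Suc K)))
     = ?\<kappa> * W * ((1 - a * (q * Z)) * (1 - b * (q * Z)) * (1 - d * (q * Z)) * (y - Z))"
    unfolding W_def qpoch_Suc[of a q "Suc K"] qpoch_Suc[of b q "Suc K"] qpoch_Suc[of d q "Suc K"]
    by (simp add: P_def Z_def)
  have kr: "?\<kappa> / r = (1 - a * q * y) * y" using nz by (simp add: r_def)
  have "(1 - a * q * y / b) * (1 - a * q * y / d) * vwp_term a b d q (q * y) (Suc K)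
     - (1 - a * q * y) * (1 - a * q * y / (b * d)) * vwp_term a b d q y (Suc K)
     = W * (1 - a * q * y) * ((1 - a * q^2 * Z^2) * ((q * y - 1) * Z * (1 - a * q * y / b) * (1 - a * q * y / d)
           - (1 - a * q * y / (b * d)) * (y - Z) * (1 - a * q * (q * Z) * y)))"
  proof -
    have gen: "\<beta> * \<delta> * (W * (A * (e * Z) * x)) - x * \<gamma> * (W * (A * t * w)) = W * x * (A * (e * Z * \<beta> * \<delta> - \<gamma> * t * w))"
      for \<beta> \<delta> A e x \<gamma> t w by (simp add: algebra_simps)
    show ?thesis unfolding t1 t2 by (rule gen)
  qed
  also have "\<dots> = ?\<kappa> * W * ((1 - a * (q * Z)) * (1 - b * (q * Z)) * (1 - d * (q * Z)) * (y - Z))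
     - ?\<kappa> / r * W * ((1 - q * Z) * (1 - a * q / b * Z) * (1 - a * q / d * Z) * (1 - a * q * y * (q * Z)))"
  proof -
    have gen: "W * x * (\<rho> * A1 * A2 * A3 * t - y * B1 * B2 * B3 * B4)
      = x * \<rho> * W * (A1 * A2 * A3 * t) - x * y * W * (B1 * B2 * B3 * B4)"
      for x \<rho> A1 A2 A3 t B1 B2 B3 B4 by (simp add: algebra_simps)
    show ?thesis unfolding wz_identity[OF nz] kr by (rule gen)
  qed
  finally have step: "(1 - a * q * y / b) * (1 - a * q * y / d) * vwp_term a b d q (q * y) (Suc K)
     - (1 - a * q * y) * (1 - a * q * y / (b * d)) * vwp_term a b d q y (Suc K) = \<dots>" .
  have add: "\<beta> * (S + s) - \<gamma> * (T + t) = G2"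
    if "\<beta> * S - \<gamma> * T = G1" "\<beta> * s - \<gamma> * t = G2 - G1" for \<beta> \<gamma> S T s t G1 G2 :: 'a
    using that by (simp add: algebra_simps)
  show ?case
    unfolding sum.atMost_Suc r_def[symmetric] g2
    by (rule add[OF Suc.IH[unfolded r_def[symmetric] P_def[symmetric] g1] step])
qed

text \<open>For \<open>y = q ^ M\<close> and \<open>K = Suc M\<close> the certificate of
  \<open>vwp_partial_sum\<close> contains the factor \<open>y - q ^ M = 0\<close>. What remains is a
  two-term recursion in \<open>M\<close>, which the product solves.\<close>

lemma vwp_sum:
  fixes a b d q :: "'a::field"
  assumes nz: "a \<noteq> 0" "b \<noteq> 0" "d \<noteq> 0" "q \<noteq> 0"
    and q1: "\<And>j. q * q ^ j \<noteq> 1"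
    and a1: "\<And>j. a * q * q ^ j \<noteq> 1"
    and b1: "\<And>j. a * q / b * q ^ j \<noteq> 1"
    and d1: "\<And>j. a * q / d * q ^ j \<noteq> 1"
  shows "(\<Sum>k\<le>M. vwp_term a b d q (q ^ M) k)
    = (1 - a) * qpoch (a * q) q M * qpoch (a * q / (b * d)) q M / (qpoch (a * q / b) q M * qpoch (a * q / d) q M)"
proof (induction M)
  case 0
  then show ?case by (simp add: vwp_term_def)
next
  case (Suc M)
  let ?y = "q ^ M"
  have y1: "a * q * ?y * q ^ j \<noteq> 1" for j using a1[of "M + j"] by (simp add: power_add mult_ac)
  \<comment> \<open>The factor \<open>j = M\<close> vanishes, so both sums may run up to
    \<open>Suc M\<close>.\<close>
  have "vwp_term a b d q ?y (Suc M) = 0" by (simp add: vwp_term_def)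
  then have S: "(\<Sum>k\<le>Suc M. vwp_term a b d q ?y k) = (\<Sum>k\<le>M. vwp_term a b d q ?y k)" by simp
  have f: "1 - a * q * ?y / b \<noteq> 0" "1 - a * q * ?y / d \<noteq> 0"
    using b1[of M] d1[of M] by simp_all
  have "(1 - a * q * ?y / b) * (1 - a * q * ?y / d) * (\<Sum>k\<le>Suc M. vwp_term a b d q (q * ?y) k)
     = (1 - a * q * ?y) * (1 - a * q * ?y / (b * d)) * (\<Sum>k\<le>Suc M. vwp_term a b d q ?y k)"
    using vwp_partial_sum[OF nz q1 b1 d1 y1, of "Suc M"] by simp
  then have "(\<Sum>k\<le>Suc M. vwp_term a b d q (q * ?y) k)
     = (1 - a * q * ?y) * (1 - a * q * ?y / (b * d)) * (\<Sum>k\<le>M. vwp_term a b d q ?y k)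
       / ((1 - a * q * ?y / b) * (1 - a * q * ?y / d))"
    unfolding S using f by (simp add: eq_divide_eq mult_ac)
  then show ?case unfolding Suc.IH by (simp add: qpoch_Suc mult_ac)
qed

subsection \<open>Congruences modulo powers of a cyclotomic polynomial\<close>

text \<open>
  \<open>V i\<close> stands for the elements of the local ring at \<open>\<Phi>\<^sub>n(q)\<close> that are divisible by \<open>\<Phi>\<^sub>n(q)\<^sup>i\<close>;
  a congruence modulo \<open>\<Phi>\<^sub>n(q)\<^sup>i\<close> is written \<open>x - y \<in> V i\<close>.
\<close>
locale cyclotomic_filtration =
  fixes q :: "'a::field" and n :: nat and V :: "nat \<Rightarrow> 'a set"
  assumes zero_V [simp]: "0 \<in> V i"
    and one_V0 [simp]: "1 \<in> V 0"
    and add_V: "x \<in> V i \<Longrightarrow> y \<in> V i \<Longrightarrow> x + y \<in> V i"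
    and uminus_V: "x \<in> V i \<Longrightarrow> - x \<in> V i"
    and mult_V: "x \<in> V i \<Longrightarrow> y \<in> V j \<Longrightarrow> x * y \<in> V (i + j)"
    and V_Suc_subset: "V (Suc i) \<subseteq> V i"
    and q_V0: "q \<in> V 0"
    and inverse_q_V0: "inverse q \<in> V 0"
    and q_nonzero [simp]: "q \<noteq> 0"
    and q_power_neq_1: "j > 0 \<Longrightarrow> q ^ j \<noteq> 1"
    and one_minus_q_power_V1: "1 - q ^ n \<in> V 1"
    and inverse_V0: "\<not> n dvd j \<Longrightarrow> inverse (1 - q ^ j) \<in> V 0"
begin

lemma diff_V: "x \<in> V i \<Longrightarrow> y \<in> V i \<Longrightarrow> x - y \<in> V i"
  using add_V[of x i "- y"] uminus_V[of y i] by simp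

lemma V_subset: "j \<le> i \<Longrightarrow> x \<in> V i \<Longrightarrow> x \<in> V j"
  by (induction i) (use V_Suc_subset in \<open>auto simp: le_Suc_eq\<close>)

lemma mult_V_left: "x \<in> V 0 \<Longrightarrow> y \<in> V i \<Longrightarrow> x * y \<in> V i"
  using mult_V[of x 0 y i] by simp

lemma mult_V_right: "x \<in> V i \<Longrightarrow> y \<in> V 0 \<Longrightarrow> x * y \<in> V i"
  using mult_V[of x i y 0] by simp

lemma sum_V: "(\<And>k. k \<in> S \<Longrightarrow> f k \<in> V i) \<Longrightarrow> sum f S \<in> V i"
  by (induction S rule: infinite_finite_induct) (auto intro: add_V)

lemma prod_V0: "(\<And>k. k \<in> S \<Longrightarrow> f k \<in> V 0) \<Longrightarrow> prod f S \<in> V 0"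
  by (induction S rule: infinite_finite_induct) (auto intro: mult_V_left)

lemma power_V0: "x \<in> V 0 \<Longrightarrow> x ^ k \<in> V 0"
  by (induction k) (auto intro: mult_V_left)

lemma of_nat_V0: "of_nat k \<in> V 0"
  by (induction k) (auto intro: add_V)

lemma numeral_V0: "numeral k \<in> V 0"
  using of_nat_V0[of "numeral k"] by simp

lemma cong_V_sym: "x - y \<in> V i \<Longrightarrow> y - x \<in> V i"
  using uminus_V[of "x - y" i] by simp

lemma cong_V_mult:
  assumes "x - x' \<in> V i" "y - y' \<in> V i" "y \<in> V 0" "x' \<in> V 0"
  shows "x * y - x' * y' \<in> V i"
proof -
  have "x * y - x' * y' = (x - x') * y + x' * (y - y')" by (simp add: algebra_simps)
  then show ?thesis using assms by (auto intro: add_V mult_V_left mult_V_right)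
qed

lemma cong_V_prod:
  assumes "\<And>k. k \<in> S \<Longrightarrow> f k - g k \<in> V i" "\<And>k. k \<in> S \<Longrightarrow> f k \<in> V 0" "\<And>k. k \<in> S \<Longrightarrow> g k \<in> V 0"
  shows "prod f S - prod g S \<in> V i"
  using assms
proof (induction S rule: infinite_finite_induct)
  case (insert x S)
  then show ?case by (simp add: cong_V_mult prod_V0)
qed auto

lemma cong_V_power:
  assumes "x - y \<in> V i" "x \<in> V 0" "y \<in> V 0"
  shows "x ^ k - y ^ k \<in> V i"
  using cong_V_prod[of "{..<k}" "\<lambda>_. x" "\<lambda>_. y" i] assms by simp

lemma cong_V_divide:
  assumes "x - x' \<in> V i" "y - y' \<in> V i" "x' \<in> V 0" "y' \<in> V 0"
    "inverse y \<in> V 0" "inverse y' \<in> V 0" "y \<noteq> 0" "y' \<noteq> 0"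
  shows "x / y - x' / y' \<in> V i"
proof -
  have "x / y - x' / y' = ((x - x') * y' + x' * (y' - y)) * (inverse y * inverse y')"
    using assms(7,8) by (simp add: field_simps)
  moreover have "(x - x') * y' + x' * (y' - y) \<in> V i"
    by (intro add_V mult_V_right[OF assms(1,4)] mult_V_left[OF assms(3) cong_V_sym[OF assms(2)]])
  ultimately show ?thesis using mult_V_left[OF assms(5,6)] by (simp add: mult_V_right)
qed

section \<open>Integer powers of q\<close>

abbreviation qe :: "int \<Rightarrow> 'a" where "qe i \<equiv> q powi i"

lemma qe_add: "qe (i + j) = qe i * qe j"
  by (simp add: power_int_add)

lemma qe_V0 [simp]: "qe i \<in> V 0"
  by (simp add: power_int_def power_V0 q_V0 inverse_q_V0)

lemma qe_eq_1_iff [simp]: "qe i = 1 \<longleftrightarrow> i = 0"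
proof
  assume *: "qe i = 1"
  have "q ^ nat \<bar>i\<bar> = 1" using * by (cases "i \<ge> 0") (auto simp: power_int_def power_inverse)
  then show "i = 0" using q_power_neq_1[of "nat \<bar>i\<bar>"] by (cases "i = 0") auto
qed simp

lemma one_minus_qe_V0: "1 - qe i \<in> V 0"
  by (intro diff_V) auto

text \<open>Negative exponents reduce to positive ones by 1 - q^(-j) = -q^(-j) (1 - q^j).\<close>

lemma inverse_one_minus_qe_V0:
  assumes "\<not> int n dvd i"
  shows "inverse (1 - qe i) \<in> V 0"
proof (cases "i \<ge> 0")
  case True
  then obtain j where j: "i = int j" by (metis nonneg_int_cases)
  then show ?thesis using assms inverse_V0[of j] by simp
next
  case False
  then obtain j where j: "i = - int j" by (metis int_cases2 of_nat_0_le_iff)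
  then have nd: "\<not> n dvd j" using assms by simp
  then have "1 - q ^ j \<noteq> 0" using q_power_neq_1[of j] by (cases "j = 0") auto
  then have "inverse (1 - qe i) = - (q ^ j) * inverse (1 - q ^ j)"
    unfolding j power_int_minus power_int_of_nat by (auto simp: field_simps)
  moreover have "- (q ^ j) * inverse (1 - q ^ j) \<in> V 0"
    by (intro mult_V_left uminus_V power_V0 q_V0 inverse_V0 nd)
  ultimately show ?thesis by simp
qed

text \<open>1 - X divides 1 - X^k for X = q^n; a negative multiple of \<open>n\<close> only costs
  the unit \<open>qe i\<close>.\<close>

lemma one_minus_qe_V1:
  assumes "int n dvd i"
  shows "1 - qe i \<in> V 1"
proof -
  obtain c where i: "i = int n * c" using assms by (elim dvdE)
  have a: "1 - (q ^ n) ^ k \<in> V 1" for k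
    using cong_V_power[of 1 "q ^ n" 1 k] one_minus_q_power_V1 by (simp add: power_V0 q_V0)
  show ?thesis
  proof (cases "c \<ge> 0")
    case True
    then have "qe i = (q ^ n) ^ nat c" unfolding i power_int_mult by (simp add: power_int_def)
    then show ?thesis using a by simp
  next
    case False
    then have "qe i = inverse ((q ^ n) ^ nat (- c))"
      unfolding i power_int_mult by (simp add: power_int_def power_inverse)
    then have "1 - qe i = - (qe i * (1 - (q ^ n) ^ nat (- c)))" by (simp add: right_diff_distrib)
    then show ?thesis using a[of "nat (- c)"] by (auto intro!: uminus_V mult_V_left)
  qed
qed

lemma cong_V_qe:
  assumes "int n dvd i - j"
  shows "qe i - qe j \<in> V 1"
proof -
  have "qe i - qe j = - (qe j * (1 - qe (i - j)))" using qe_add[of j "i - j"] by (simp add: algebra_simps)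
  then show ?thesis using one_minus_qe_V1[OF assms] by (simp add: uminus_V mult_V_left)
qed

lemma cong_V_one_minus_qe: "int n dvd i - j \<Longrightarrow> (1 - qe i) - (1 - qe j) \<in> V 1"
  using cong_V_sym[OF cong_V_qe[of i j]] by simp

lemma one_minus_qe_nonzero [simp]: "i \<noteq> 0 \<Longrightarrow> 1 - qe i \<noteq> 0"
  using qe_eq_1_iff[of i] by auto

text \<open>The binomial expansion of (1 + x)^k to first order in x = q^n - 1.\<close>

lemma cong_V2_power:
  "(q ^ n) ^ k - (1 + of_nat k * (q ^ n - 1)) \<in> V 2"
proof (induction k)
  case (Suc k)
  let ?x = "q ^ n - 1"
  have x: "?x \<in> V 1" using uminus_V[OF one_minus_q_power_V1] by simp
  have "(q ^ n) ^ Suc k - (1 + of_nat (Suc k) * ?x)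
    = q ^ n * ((q ^ n) ^ k - (1 + of_nat k * ?x)) + of_nat k * (?x * ?x)"
    by (simp add: algebra_simps)
  moreover have "?x * ?x \<in> V 2" using mult_V[OF x x] by (simp add: numeral_2_eq_2)
  ultimately show ?case using Suc by (auto intro!: add_V mult_V_left power_V0 q_V0 of_nat_V0)
qed simp

lemma qpoch_qe: "qpoch (qe i) (q\<^sup>2) k = (\<Prod>j<k. 1 - qe (i + 2 * int j))"
  unfolding qpoch_def
proof (intro prod.cong refl)
  fix j
  have "(q\<^sup>2) ^ j = qe (2 * int j)"
    using power_int_of_nat[of q "2 * j"] by (simp add: power_mult)
  then show "1 - qe i * (q\<^sup>2) ^ j = 1 - qe (i + 2 * int j)" by (simp add: qe_add)
qed

end

subsection \<open>The supercongruence for an abstract filtration\<close>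

text \<open>Two has to be a unit because the argument halves twice: for the average over two values
  of \<open>\<delta>\<close> and for the pairing of k with 2m - k.\<close>

locale cyclotomic_filtration_1_mod_4 = cyclotomic_filtration +
  fixes m :: nat
  assumes n_eq: "n = 4 * m + 1" and m_pos: "m > 0"
    and inverse_2_V0: "inverse 2 \<in> V 0" and two_nonzero: "(2 :: 'a) \<noteq> 0"
begin

lemma not_dvd_near_multiple:
  assumes "i \<noteq> c * int n" "\<bar>i - c * int n\<bar> < int n"
  shows "\<not> int n dvd i"
proof
  assume "int n dvd i"
  then have "int n dvd i - c * int n" by simp
  with assms show False using dvd_imp_le_int[of "i - c * int n" "int n"] by auto
qed

lemma not_dvd_small: "i \<noteq> 0 \<Longrightarrow> \<bar>i\<bar> < int n \<Longrightarrow> \<not> int n dvd i"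
  using not_dvd_near_multiple[of i 0] by simp

lemma divide_V0: "x \<in> V 0 \<Longrightarrow> inverse y \<in> V 0 \<Longrightarrow> x / y \<in> V 0"
  unfolding divide_inverse by (rule mult_V_left)

lemma q_power_n: "q ^ n = qe (int n)"
  by simp

text \<open>
  \<open>g' k\<close> is \<open>(g k)\<^sup>2\<close> with its parameters shifted by \<open>q\<^sup>n\<close> and \<open>q\<^sup>-\<^sup>n\<close>, and \<open>R \<delta> k\<close> collects the factors
  of the summand that involve the remaining parameter \<open>d = q\<^sup>\<delta>\<close>. For \<open>\<delta> = 3/2\<close> it would be
  \<open>q\<^sup>-\<^sup>k\<^sup>/\<^sup>2\<close>; the values \<open>\<delta> = (3 \<plusminus> n)/2\<close> used below are integers.
\<close>
definition g :: "nat \<Rightarrow> 'a" where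
  "g k = (\<Prod>j<k. (1 - qe (1 + 2 * int j)) / (1 - qe (2 + 2 * int j)))"

definition g' :: "nat \<Rightarrow> 'a" where
  "g' k = (\<Prod>j<k. ((1 - qe (2 * int j - 4 * int m)) * (1 - qe (2 * int j - 4 * int m + 2 * int n)))
     / ((1 - qe (2 * int j + 1 - 4 * int m)) * (1 - qe (2 * int j + 1 - 4 * int m + 2 * int n))))"

text \<open>The value q^(-k/2) belonging to \<open>\<delta>\<close> = 3/2, with 1/2 replaced by 2m +
  1 = (n + 1)/2, the inverse of 2 modulo \<open>n\<close>.\<close>

definition c :: "nat \<Rightarrow> 'a" where
  "c k = qe (- int k * (2 * int m + 1))"

definition R :: "int \<Rightarrow> nat \<Rightarrow> 'a" where
  "R \<delta> k = (\<Prod>j<k. (1 - qe (\<delta> + 2 * int j)) / (1 - qe (3 - \<delta> + 2 * int j))) * qe (int k * (1 - \<delta>))"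

section \<open>The shifted factors and the closed form\<close>

lemma g_V0:
  assumes "k \<le> 2 * m"
  shows "g k \<in> V 0"
  unfolding g_def
proof (intro prod_V0 divide_V0 one_minus_qe_V0 inverse_one_minus_qe_V0 not_dvd_small)
  fix j assume "j \<in> {..<k}"
  then show "2 + 2 * int j \<noteq> 0" "\<bar>2 + 2 * int j\<bar> < int n" using assms n_eq by auto
qed

text \<open>With t = q^i and X = q^n the difference is -t (1 - X)^2: opposite shifts cancel to first
  order.\<close>

lemma cong_V2_opposite_shifts:
  "(1 - qe i) * (1 - qe (i + 2 * int n)) - (1 - qe (i + int n))\<^sup>2 \<in> V 2"
proof -
  let ?x = "1 - q ^ n"
  have e: "qe (i + 2 * int n) = qe i * q ^ n * q ^ n" "qe (i + int n) = qe i * q ^ n"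
    unfolding q_power_n by (simp_all only: mult_2 qe_add mult.assoc)
  have "(1 - qe i) * (1 - qe (i + 2 * int n)) - (1 - qe (i + int n))\<^sup>2 = - (qe i * (?x * ?x))"
    unfolding e by (simp add: algebra_simps power2_eq_square)
  moreover have "?x * ?x \<in> V 2"
    using mult_V[OF one_minus_q_power_V1 one_minus_q_power_V1] by (simp add: numeral_2_eq_2)
  ultimately show ?thesis by (simp add: uminus_V mult_V_left)
qed

lemma g'_V0_cong:
  assumes "k \<le> 2 * m"
  shows "g' k \<in> V 0" and "g' k - (g k)\<^sup>2 \<in> V 2"
proof -
  define num where "num j = (1 - qe (2 * int j - 4 * int m)) * (1 - qe (2 * int j - 4 * int m + 2 * int n))" for j
  define den where "den j = (1 - qe (2 * int j + 1 - 4 * int m)) * (1 - qe (2 * int j + 1 - 4 * int m + 2 * int n))" for j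
  have g': "g' k = (\<Prod>j<k. num j / den j)" by (simp add: g'_def num_def den_def)
  have g: "(g k)\<^sup>2 = (\<Prod>j<k. (1 - qe (1 + 2 * int j))\<^sup>2 / (1 - qe (2 + 2 * int j))\<^sup>2)"
    by (simp add: g_def prod_power_distrib power_divide)
  have nd: "\<not> int n dvd 2 * int j + 1 - 4 * int m" "\<not> int n dvd 2 * int j + 1 - 4 * int m + 2 * int n"
    "\<not> int n dvd 2 + 2 * int j" if "j < k" for j
  proof -
    show "\<not> int n dvd 2 * int j + 1 - 4 * int m" "\<not> int n dvd 2 + 2 * int j"
      by (rule not_dvd_small; use that assms n_eq in presburger)+
    then show "\<not> int n dvd 2 * int j + 1 - 4 * int m + 2 * int n"
      by (simp add: dvd_add_left_iff)
  qed
  have nz: "2 * int j + 1 - 4 * int m \<noteq> 0" "2 * int j + 1 - 4 * int m + 2 * int n \<noteq> 0" for j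
    by presburger+
  have inum: "num j \<in> V 0" for j
    unfolding num_def by (intro mult_V_left one_minus_qe_V0)
  have iden: "inverse (den j) \<in> V 0" "den j \<noteq> 0" if "j < k" for j
    unfolding den_def inverse_mult_distrib using nd[OF that] nz[of j]
    by (auto intro!: mult_V_left inverse_one_minus_qe_V0 one_minus_qe_nonzero)
  have i2: "inverse ((1 - qe (2 + 2 * int j))\<^sup>2) \<in> V 0" if "j < k" for j
    unfolding power_inverse[symmetric] by (intro power_V0 inverse_one_minus_qe_V0 nd(3) that)
  have cn: "num j - (1 - qe (1 + 2 * int j))\<^sup>2 \<in> V 2" "den j - (1 - qe (2 + 2 * int j))\<^sup>2 \<in> V 2" for j
  proof -
    \<comment> \<open>Since n = 4m + 1, the midpoint of each pair of shifted exponents is the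
      exponent in \<open>g\<close>.\<close>
    have e: "2 * int j - 4 * int m + int n = 1 + 2 * int j" "2 * int j + 1 - 4 * int m + int n = 2 + 2 * int j"
      by (simp_all add: n_eq)
    show "num j - (1 - qe (1 + 2 * int j))\<^sup>2 \<in> V 2" "den j - (1 - qe (2 + 2 * int j))\<^sup>2 \<in> V 2"
      unfolding num_def den_def
      using cong_V2_opposite_shifts[of "2 * int j - 4 * int m", unfolded e]
        cong_V2_opposite_shifts[of "2 * int j + 1 - 4 * int m", unfolded e] .
  qed
  show "g' k \<in> V 0" unfolding g' by (auto intro!: prod_V0 divide_V0 inum iden)
  show "g' k - (g k)\<^sup>2 \<in> V 2"
    unfolding g' g
    by (intro cong_V_prod cong_V_divide divide_V0 inum iden i2 cn power_V0 one_minus_qe_V0)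
       (auto simp: iden)
qed

text \<open>As \<open>n\<close> divides 2 \<open>\<delta>\<close> - 3, the exponents
  \<open>\<delta>\<close> + 2j and 3 - \<open>\<delta>\<close> + 2j agree modulo \<open>n\<close>,
  so each quotient is congruent to 1 and only the power of q remains.\<close>

lemma R_cong:
  assumes "\<And>j. j < k \<Longrightarrow> \<not> int n dvd 3 - \<delta> + 2 * int j" "int n dvd 2 * \<delta> - 3"
    and "\<And>j. 3 - \<delta> + 2 * int j \<noteq> 0"
  shows "R \<delta> k - c k \<in> V 1" and "R \<delta> k \<in> V 0"
proof -
  have i: "inverse (1 - qe (3 - \<delta> + 2 * int j)) \<in> V 0" if "j < k" for j
    by (intro inverse_one_minus_qe_V0 assms that)
  have "(1 - qe (\<delta> + 2 * int j)) / (1 - qe (3 - \<delta> + 2 * int j)) - 1 \<in> V 1" if "j < k" for j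
  proof -
    have "int n dvd (\<delta> + 2 * int j) - (3 - \<delta> + 2 * int j)" using assms(2) by (simp add: algebra_simps)
    note cong_V_one_minus_qe[OF this]
    then have "(1 - qe (\<delta> + 2 * int j)) / (1 - qe (3 - \<delta> + 2 * int j))
      - (1 - qe (3 - \<delta> + 2 * int j)) / (1 - qe (3 - \<delta> + 2 * int j)) \<in> V 1"
      by (intro cong_V_divide i that one_minus_qe_V0 one_minus_qe_nonzero assms(3)) auto
    then show ?thesis using one_minus_qe_nonzero[OF assms(3), of j] by simp
  qed
  then have 1: "(\<Prod>j<k. (1 - qe (\<delta> + 2 * int j)) / (1 - qe (3 - \<delta> + 2 * int j))) - (\<Prod>j<k. 1) \<in> V 1"
    by (intro cong_V_prod) (auto intro!: divide_V0 one_minus_qe_V0 i)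
  \<comment> \<open>The exponents are compared after doubling, since the hypothesis concerns 2
    \<open>\<delta>\<close>; \<open>n\<close> is odd, so the factor 2 cancels.\<close>
  have "2 * (int k * (1 - \<delta>) - (- int k * (2 * int m + 1))) = int k * (int n - (2 * \<delta> - 3))"
    by (simp add: n_eq algebra_simps)
  then have "int n dvd 2 * (int k * (1 - \<delta>) - (- int k * (2 * int m + 1)))" using assms(2) by simp
  moreover have "coprime (int n) 2" by (simp add: n_eq)
  ultimately have "int n dvd int k * (1 - \<delta>) - (- int k * (2 * int m + 1))"
    using coprime_dvd_mult_right_iff by blast
  then have 2: "qe (int k * (1 - \<delta>)) - c k \<in> V 1" unfolding c_def by (rule cong_V_qe)
  show "R \<delta> k - c k \<in> V 1" using cong_V_mult[OF 1 2] unfolding R_def by simp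
  show "R \<delta> k \<in> V 0" unfolding R_def
    by (intro mult_V_left prod_V0 divide_V0 one_minus_qe_V0 i) auto
qed

text \<open>In base q^2 the parameters are a = q, b = q^(1+n) and the terminating one q^(1-n). Then
  \<open>g\<close> comes from a, \<open>g'\<close> from b and the termination, and \<open>R\<close>
  from d.\<close>

lemma vwp_term_eq:
  "vwp_term q (qe (4 * int m + 2)) (qe \<delta>) (q\<^sup>2) ((q\<^sup>2) ^ (2 * m)) k
     = (1 - qe (1 + 4 * int k)) * g k * g' k * R \<delta> k"
proof -
  have q: "q = qe 1" "q\<^sup>2 = qe 2" using power_int_of_nat[of q 2] by simp_all
  have qp: "(q\<^sup>2) ^ j = qe (2 * int j)" for j
    using power_int_of_nat[of q "2 * j"] by (simp add: power_mult)
  have e: "qe i * qe j = qe (i + j)" "qe i / qe j = qe (i - j)" for i j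
    by (simp_all add: power_int_add power_int_diff)
  have p: "qe i ^ k = qe (int k * i)" for i
    using power_int_mult[of q i "int k"] by (simp add: mult.commute)
  have pr: "(\<Prod>j<k. (q\<^sup>2) ^ (2 * m) - (q\<^sup>2) ^ j) = qe (int k * (4 * int m)) * (\<Prod>j<k. 1 - qe (2 * int j - 4 * int m))"
  proof -
    have "(\<Prod>j<k. (q\<^sup>2) ^ (2 * m) - (q\<^sup>2) ^ j) = (\<Prod>j<k. qe (4 * int m) * (1 - qe (2 * int j - 4 * int m)))"
      by (intro prod.cong refl) (simp add: qp right_diff_distrib e)
    then show ?thesis by (simp add: prod.distrib p)
  qed
  have x: "q * (q\<^sup>2) ^ (2 * k) = qe (1 + 4 * int k)" using e(1)[of 1 "4 * int k"] by (simp add: qp)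
  have q3: "q * q\<^sup>2 = qe 3" using power_int_of_nat[of q 3] by (simp add: power2_eq_square power3_eq_cube mult.assoc)
  have x1: "q * q\<^sup>2 / qe (4 * int m + 2) = qe (1 - 4 * int m)" "q * q\<^sup>2 / qe \<delta> = qe (3 - \<delta>)"
    "q * q\<^sup>2 * (q\<^sup>2) ^ (2 * m) = qe (3 + 4 * int m)"
    "q * q\<^sup>2 / (qe (4 * int m + 2) * qe \<delta>) = qe (1 - 4 * int m - \<delta>)"
    unfolding q3 qp e by (simp_all add: algebra_simps)
  have y: "qpoch q (q\<^sup>2) k = qpoch (qe 1) (q\<^sup>2) k" "qpoch (q\<^sup>2) (q\<^sup>2) k = qpoch (qe 2) (q\<^sup>2) k"
    using q by simp_all
  \<comment> \<open>The power \<open>y ^ k\<close> pulled out of the terminating product cancels the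
    4m in the argument of the series.\<close>
  have ex: "qe (int k * (1 - \<delta>)) = qe (int k * (4 * int m)) * qe (int k * (1 - 4 * int m - \<delta>))"
    unfolding e by (simp add: algebra_simps)
  have sh: "2 * int j - 4 * int m + 2 * int n = 4 * int m + 2 + 2 * int j"
     "2 * int j + 1 - 4 * int m + 2 * int n = 3 + 4 * int m + 2 * int j"
     "2 * int j + 1 - 4 * int m = 1 - 4 * int m + 2 * int j" for j by (simp_all add: n_eq)
  show ?thesis
    unfolding vwp_term_def x x1 pr y qpoch_qe g_def g'_def R_def ex p sh(1,2)
    unfolding sh(3) prod_dividef prod.distrib
    by (simp add: mult_ac)
qed

text \<open>
  In the closed form one factor \<open>\<Phi>\<^sub>n(q)\<close> comes from \<open>(q\<^sup>3;q\<^sup>2)\<close>, whose last factor is \<open>1 - q\<^sup>n\<close>,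
  and the other from \<open>(q\<^sup>3/(b d);q\<^sup>2)\<close>.
\<close>
lemma vwp_sum_V2:
  assumes v: "j0 < 2 * m" "int n dvd 1 - 4 * int m - \<delta> + 2 * int j0"
    and nd: "\<And>j. j < 2 * m \<Longrightarrow> \<not> int n dvd 3 - \<delta> + 2 * int j"
    and nz: "\<And>j. 3 - \<delta> + 2 * int j \<noteq> 0"
  shows "(\<Sum>k\<le>2 * m. (1 - qe (1 + 4 * int k)) * g k * g' k * R \<delta> k) \<in> V 2"
proof -
  have q: "q = qe 1" "q\<^sup>2 = qe 2" using power_int_of_nat[of q 2] by simp_all
  have qp: "(q\<^sup>2) ^ j = qe (2 * int j)" for j
    using power_int_of_nat[of q "2 * j"] by (simp add: power_mult)
  have e: "qe i * qe j = qe (i + j)" "qe i / qe j = qe (i - j)" for i j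
    by (simp_all add: power_int_add power_int_diff)
  have q3: "q * q\<^sup>2 = qe 3" using power_int_of_nat[of q 3] by (simp add: power2_eq_square power3_eq_cube mult.assoc)
  have x1: "q * q\<^sup>2 / qe (4 * int m + 2) = qe (1 - 4 * int m)" "q * q\<^sup>2 / qe \<delta> = qe (3 - \<delta>)"
    "q * q\<^sup>2 / (qe (4 * int m + 2) * qe \<delta>) = qe (1 - 4 * int m - \<delta>)" "q * q\<^sup>2 = qe 3"
    unfolding q3 e by (simp_all add: algebra_simps)
  have S: "(\<Sum>k\<le>2 * m. (1 - qe (1 + 4 * int k)) * g k * g' k * R \<delta> k)
    = (1 - q) * qpoch (qe 3) (q\<^sup>2) (2 * m) * qpoch (qe (1 - 4 * int m - \<delta>)) (q\<^sup>2) (2 * m)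
      / (qpoch (qe (1 - 4 * int m)) (q\<^sup>2) (2 * m) * qpoch (qe (3 - \<delta>)) (q\<^sup>2) (2 * m))"
    unfolding vwp_term_eq[symmetric] x1[symmetric]
  proof (rule vwp_sum)
    fix j
    show "q\<^sup>2 * (q\<^sup>2) ^ j \<noteq> 1" unfolding qp unfolding q(2) e qe_eq_1_iff by simp
    show "q * q\<^sup>2 * (q\<^sup>2) ^ j \<noteq> 1" unfolding qp x1 e qe_eq_1_iff by simp
    show "q * q\<^sup>2 / qe (4 * int m + 2) * (q\<^sup>2) ^ j \<noteq> 1" unfolding qp x1 e qe_eq_1_iff by presburger
    show "q * q\<^sup>2 / qe \<delta> * (q\<^sup>2) ^ j \<noteq> 1" unfolding qp x1 e qe_eq_1_iff by (rule nz)
  qed auto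
  have V1: "qpoch (qe i) (q\<^sup>2) (2 * m) \<in> V 1" if "j < 2 * m" "int n dvd i + 2 * int j" for i j
    unfolding qpoch_qe using that
    by (subst prod.remove[of _ j]) (auto intro!: mult_V_right one_minus_qe_V1 prod_V0 one_minus_qe_V0 simp del: One_nat_def)
  have I0: "inverse (qpoch (qe i) (q\<^sup>2) (2 * m)) \<in> V 0" if "\<And>j. j < 2 * m \<Longrightarrow> \<not> int n dvd i + 2 * int j" for i
    unfolding qpoch_qe prod_inversef[symmetric] using that by (auto intro!: prod_V0 inverse_one_minus_qe_V0)
  have V1': "qpoch (qe 3) (q\<^sup>2) (2 * m) \<in> V 1" by (rule V1[of "2 * m - 1"]) (use m_pos n_eq in auto)
  have 1: "qpoch (qe 3) (q\<^sup>2) (2 * m) * qpoch (qe (1 - 4 * int m - \<delta>)) (q\<^sup>2) (2 * m) \<in> V 2"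
    using mult_V[OF V1' V1[OF v]] by (simp add: numeral_2_eq_2)
  have 2: "inverse (qpoch (qe (1 - 4 * int m)) (q\<^sup>2) (2 * m)) \<in> V 0"
    by (intro I0 not_dvd_small) (use n_eq in presburger)+
  have 3: "inverse (qpoch (qe (3 - \<delta>)) (q\<^sup>2) (2 * m)) \<in> V 0" by (intro I0 nd)
  have 4: "1 - q \<in> V 0" using one_minus_qe_V0[of 1] by simp
  show ?thesis
    unfolding S using mult_V_left[OF 4 mult_V_right[OF mult_V_right[OF 1 2] 3]]
    by (simp only: divide_inverse inverse_mult_distrib mult_ac)
qed

section \<open>The power of q against the average of two values of \<open>R\<close>\<close>

definition h :: "nat \<Rightarrow> nat" where
  "h k = (k * (2 * m + 1 - k)) div 2"

text \<open>k and 2m + 1 - k have opposite parity, so the halving is exact. Of the two parts, k (2m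
  - k) is the weight symmetric under reflection, and k is the exponent of q^n in
  \<open>R_mult\<close>.\<close>

lemma two_h:
  assumes "k \<le> 2 * m"
  shows "2 * h k = k * (2 * m - k) + k"
proof -
  have "even (k * (2 * m + 1 - k))" using assms by (cases "even k") auto
  then have "2 * h k = k * (2 * m + 1 - k)" by (simp add: h_def)
  also have "2 * m + 1 - k = (2 * m - k) + 1" using assms by simp
  finally show ?thesis by (simp add: algebra_simps)
qed

text \<open>Here and below, \<open>A\<close> refers to \<open>\<delta>\<close> = 2m + 2 = (3 + n)/2
  and \<open>B\<close> to \<open>\<delta>\<close> = 1 - 2m = (3 - n)/2.\<close>

lemma nz_A: "3 - (2 * int m + 2) + 2 * int j \<noteq> 0" by presburger

lemma nz_B: "3 - (1 - 2 * int m) + 2 * int j \<noteq> 0" by presburger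

lemma nd_A:
  assumes "j < 2 * m"
  shows "\<not> int n dvd 3 - (2 * int m + 2) + 2 * int j"
proof (rule not_dvd_small[OF nz_A])
  show "\<bar>3 - (2 * int m + 2) + 2 * int j\<bar> < int n"
    using assms by (simp add: n_eq abs_less_iff)
qed

lemma nd_B:
  assumes "j < 2 * m"
  shows "\<not> int n dvd 3 - (1 - 2 * int m) + 2 * int j"
\<comment> \<open>The exponents run from 2m + 2 to 6m, across n itself; they are even and
  \<open>n\<close> is odd.\<close>
proof (rule not_dvd_near_multiple[of _ 1])
  show "3 - (1 - 2 * int m) + 2 * int j \<noteq> 1 * int n" unfolding n_eq by presburger
  show "\<bar>3 - (1 - 2 * int m) + 2 * int j - 1 * int n\<bar> < int n"
    using assms by (simp add: n_eq abs_less_iff)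
qed

text \<open>The two values of \<open>\<delta>\<close> add up to 3, so numerators and denominators
  swap and cancel. Both sides equal q^(-k).\<close>

lemma R_mult: "R (2 * int m + 2) k * R (1 - 2 * int m) k = c k * (c k * (q ^ n) ^ k)"
proof -
  have nz: "1 - qe (1 - 2 * int m + 2 * int j) \<noteq> 0" "1 - qe (2 * int m + 2 + 2 * int j) \<noteq> 0" for j
    by (intro one_minus_qe_nonzero; presburger)+
  have e: "3 - (2 * int m + 2) + 2 * int j = 1 - 2 * int m + 2 * int j"
    "3 - (1 - 2 * int m) + 2 * int j = 2 * int m + 2 + 2 * int j" for j by simp_all
  have "(q ^ n) ^ k = qe (int n * int k)" using power_int_mult[of q "int n" "int k"] by simp
  then have "c k * (c k * (q ^ n) ^ k) = qe (- int k)"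
    by (simp add: c_def n_eq algebra_simps flip: qe_add)
  moreover have "R (2 * int m + 2) k * R (1 - 2 * int m) k = qe (- int k)"
  proof -
    have "R (2 * int m + 2) k * R (1 - 2 * int m) k
      = (\<Prod>j<k. (1 - qe (2 * int m + 2 + 2 * int j)) / (1 - qe (1 - 2 * int m + 2 * int j))
           * ((1 - qe (1 - 2 * int m + 2 * int j)) / (1 - qe (2 * int m + 2 + 2 * int j))))
        * (qe (int k * (1 - (2 * int m + 2))) * qe (int k * (1 - (1 - 2 * int m))))"
      unfolding R_def e prod.distrib by (simp only: mult_ac)
    also have "(\<Prod>j<k. (1 - qe (2 * int m + 2 + 2 * int j)) / (1 - qe (1 - 2 * int m + 2 * int j))
           * ((1 - qe (1 - 2 * int m + 2 * int j)) / (1 - qe (2 * int m + 2 + 2 * int j)))) = (\<Prod>j<k. 1)"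
    proof -
      have "x / y * (y / x) = 1" if "x \<noteq> 0" "y \<noteq> 0" for x y :: 'a using that by simp
      then show ?thesis by (intro prod.cong refl) (use nz in blast)
    qed
    also have "qe (int k * (1 - (2 * int m + 2))) * qe (int k * (1 - (1 - 2 * int m))) = qe (- int k)"
      by (simp add: algebra_simps flip: qe_add)
    finally show ?thesis by simp
  qed
  ultimately show ?thesis by simp
qed

text \<open>
  With \<open>A\<close>, \<open>B\<close> the two values of \<open>R\<close>, the product \<open>(A - c)(B - c)\<close> vanishes to second order, so
  the sum \<open>A + B\<close> is determined by the product \<open>A B\<close>, which is a power of \<open>q\<close>.
\<close>
lemma power_vs_average:
  assumes k: "k \<le> 2 * m"
  shows "2 * (c k * (q ^ n) ^ h k) - (R (2 * int m + 2) k + R (1 - 2 * int m) k)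
    - c k * (q ^ n - 1) * of_nat (k * (2 * m - k)) \<in> V 2"
proof -
  let ?A = "R (2 * int m + 2) k" and ?B = "R (1 - 2 * int m) k" and ?x = "q ^ n - 1"
  have A: "?A - c k \<in> V 1" by (rule R_cong) (use nd_A nz_A k n_eq in auto)
  have B: "?B - c k \<in> V 1"
  proof (rule R_cong)
    show "int n dvd 2 * (1 - 2 * int m) - 3" by (rule dvdI[of _ _ "-1"]) (simp add: n_eq)
  qed (use nd_B nz_B k in auto)
  have AB: "(?A - c k) * (?B - c k) \<in> V 2" using mult_V[OF A B] by (simp add: numeral_2_eq_2)
  have c0: "c k \<noteq> 0" "c k \<in> V 0" "inverse (c k) \<in> V 0" by (simp_all add: c_def flip: power_int_minus)
  have "of_nat (2 * h k) = (of_nat (k * (2 * m - k) + k) :: 'a)" using two_h[OF k] by simp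
  then have h2: "2 * of_nat (h k) = of_nat (k * (2 * m - k)) + (of_nat k :: 'a)" by simp
  \<comment> \<open>\<open>P\<close> and \<open>Q\<close> stand for the powers of q^n with exponents
    \<open>h k\<close> and \<open>k\<close>. Both are expanded to first order in \<open>x\<close>;
    the linear terms combine to \<open>K\<close> because 2H - kk = K.\<close>
  have gen: "2 * (C * P) - (A + B) - C * x * K
     = 2 * C * (P - (1 + H * x)) - C * (Q - (1 + kk * x)) + inverse C * ((A - C) * (B - C))"
    if "A * B = C * (C * Q)" "2 * H = K + kk" "C \<noteq> 0" for A B C P Q K H kk x :: 'a
  proof -
    have 1: "inverse C * ((A - C) * (B - C)) = C * Q - A - B + C"
    proof -
      have "inverse C * ((A - C) * (B - C)) = inverse C * (A * B - C * A - C * B + C * C)" by (simp add: algebra_simps)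
      also have "\<dots> = C * Q - A - B + C" unfolding that(1) using that(3) by (simp add: field_simps)
      finally show ?thesis .
    qed
    have 2: "C * x * (2 * H) = C * x * (K + kk)" using that(2) by simp
    show ?thesis unfolding 1 using 2 by (simp add: algebra_simps)
  qed
  show ?thesis unfolding gen[OF R_mult h2 c0(1)]
    by (intro add_V diff_V mult_V_left cong_V2_power numeral_V0 c0 AB)
qed

section \<open>Antisymmetry under k to 2m - k\<close>

lemma g_Suc: "g (Suc k) = g k * ((1 - qe (1 + 2 * int k)) / (1 - qe (2 + 2 * int k)))"
  by (simp add: g_def)

text \<open>Modulo the cyclotomic polynomial \<open>n\<close> drops out of the exponents, and 1 -
  q^(-s) = -q^(-s) (1 - q^s) turns the second quotient into q^(-1) times the inverse of the
  first.\<close>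

lemma ratio_reflect:
  assumes "0 < s" "s + 1 < int n"
  shows "(1 - qe s) / (1 - qe (s + 1)) * ((1 - qe (int n - s - 1)) / (1 - qe (int n - s))) - qe (- 1) \<in> V 1"
proof -
  have nd: "\<not> int n dvd s" "\<not> int n dvd s + 1" "\<not> int n dvd int n - s" "\<not> int n dvd - s"
    by (rule not_dvd_small; use assms in presburger)+
  have nz: "1 - qe s \<noteq> 0" "1 - qe (s + 1) \<noteq> 0" "1 - qe (int n - s) \<noteq> 0" "1 - qe (- s) \<noteq> 0"
    using assms by (auto intro!: one_minus_qe_nonzero)
  have "(1 - qe (int n - s - 1)) / (1 - qe (int n - s)) - (1 - qe (- s - 1)) / (1 - qe (- s)) \<in> V 1"
    using nd nz by (intro cong_V_divide cong_V_one_minus_qe one_minus_qe_V0 inverse_one_minus_qe_V0) auto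
  moreover have "(1 - qe s) / (1 - qe (s + 1)) \<in> V 0"
    by (intro divide_V0 one_minus_qe_V0 inverse_one_minus_qe_V0 nd)
  ultimately have *: "(1 - qe s) / (1 - qe (s + 1)) * ((1 - qe (int n - s - 1)) / (1 - qe (int n - s))
      - (1 - qe (- s - 1)) / (1 - qe (- s))) \<in> V 1"
    by (rule mult_V_left[rotated])
  have 1: "1 - qe (- s - 1) = - (qe (- s - 1) * (1 - qe (s + 1)))" "1 - qe (- s) = - (qe (- s) * (1 - qe s))"
    by (simp_all add: right_diff_distrib flip: qe_add)
  have "(1 - qe s) / (1 - qe (s + 1)) * ((1 - qe (- s - 1)) / (1 - qe (- s))) = qe (- s - 1) / qe (- s)"
    unfolding 1 using nz by simp
  also have "\<dots> = qe (- 1)" by (simp flip: power_int_diff)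
  finally show ?thesis using * by (simp only: right_diff_distrib)
qed

text \<open>Induction outwards from the centre \<open>m\<close>: each step adds one quotient on the
  right and removes one on the left, and their product is q^(-1) by
  \<open>ratio_reflect\<close>.\<close>

lemma g_reflect:
  assumes "i \<le> m"
  shows "g (m + i) - qe (- int i) * g (m - i) \<in> V 1"
  using assms
proof (induction i)
  case (Suc i)
  \<comment> \<open>The numerator exponent of quotient number m - i - 1 of \<open>g\<close>;
    quotient number m + i then has the exponents n - s - 1 and n - s.\<close>
  define s where "s = 2 * int m - 2 * int i - 1"
  define r r' where "r = (1 - qe s) / (1 - qe (s + 1))" and "r' = (1 - qe (int n - s - 1)) / (1 - qe (int n - s))"
  have mi: "m - i = Suc (m - Suc i)" using Suc.prems by simp
  have a: "1 + 2 * int (m - Suc i) = s" "2 + 2 * int (m - Suc i) = s + 1" "1 + 2 * int (m + i) = int n - s - 1"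
    "2 + 2 * int (m + i) = int n - s"
    using Suc.prems by (auto simp: s_def n_eq of_nat_diff)
  have g1: "g (m - i) = g (m - Suc i) * r" unfolding mi g_Suc a r_def ..
  have g2: "g (m + Suc i) = g (m + i) * r'" unfolding add_Suc_right g_Suc a r'_def ..
  have nd: "\<not> int n dvd int n - s" by (rule not_dvd_small) (use Suc.prems s_def n_eq in presburger)+
  have r': "r' \<in> V 0" unfolding r'_def by (intro divide_V0 one_minus_qe_V0 inverse_one_minus_qe_V0 nd)
  have rr: "r * r' - qe (- 1) \<in> V 1" unfolding r_def r'_def
    by (rule ratio_reflect) (use Suc.prems s_def n_eq in presburger)+
  have "g (m + Suc i) - qe (- int (Suc i)) * g (m - Suc i)
    = (g (m + i) - qe (- int i) * g (m - i)) * r' + qe (- int i) * g (m - Suc i) * (r * r' - qe (- 1))"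
  proof -
    have e: "- int (Suc i) = - int i + - 1" by simp
    have "qe (- int (Suc i)) = qe (- int i) * qe (- 1)" unfolding e by (rule qe_add)
    then show ?thesis unfolding g1 g2 by (simp only: algebra_simps)
  qed
  moreover have "g (m + i) - qe (- int i) * g (m - i) \<in> V 1" using Suc by simp
  moreover have "qe (- int i) * g (m - Suc i) \<in> V 0" by (intro mult_V_left qe_V0 g_V0) simp
  ultimately show ?case using add_V[OF mult_V_right mult_V_left] r' rr by simp
qed simp

definition u :: "nat \<Rightarrow> 'a" where "u k = (1 - qe (1 + 4 * int k)) * g k ^ 3"

text \<open>Reflection contributes q^(-3i) from the cube of \<open>g\<close> and q^(-i) from
  \<open>c\<close>. Together they turn 1 - q^(4i) into -(1 - q^(-4i)), the negative of the opposite
  linear factor.\<close>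

lemma u_c_reflect:
  assumes "i \<le> m"
  shows "u (m + i) * c (m + i) + u (m - i) * c (m - i) \<in> V 1"
proof -
  have g: "g (m - i) \<in> V 0" "g (m + i) \<in> V 0" using assms by (auto intro: g_V0)
  have cV: "c k \<in> V 0" for k by (simp add: c_def)
  have 1: "(1 - qe (1 + 4 * int (m + i))) - (1 - qe (4 * int i)) \<in> V 1"
    "(1 - qe (1 + 4 * int (m - i))) - (1 - qe (- 4 * int i)) \<in> V 1"
    using assms by (intro cong_V_one_minus_qe; simp add: n_eq of_nat_diff)+
  have 2: "g (m + i) ^ 3 - (qe (- int i) * g (m - i)) ^ 3 \<in> V 1"
    using g by (intro cong_V_power g_reflect assms mult_V_left) auto
  have 3: "c (m + i) - c (m - i) * qe (- int i) \<in> V 1"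
    unfolding c_def qe_add[symmetric]
    by (rule cong_V_qe, rule dvdI[of _ _ "- int i"]) (use assms in \<open>simp add: n_eq of_nat_diff algebra_simps\<close>)
  have p: "u (m + i) * c (m + i) - (1 - qe (4 * int i)) * (qe (- int i) * g (m - i)) ^ 3 * (c (m - i) * qe (- int i)) \<in> V 1"
    unfolding u_def using g by (intro cong_V_mult 1 2 3 one_minus_qe_V0 power_V0 mult_V_left cV) auto
  have m: "u (m - i) * c (m - i) - (1 - qe (- 4 * int i)) * g (m - i) ^ 3 * c (m - i) \<in> V 1"
    unfolding u_def using g by (intro cong_V_mult 1 one_minus_qe_V0 power_V0 mult_V_left cV) auto
  have "x ^ 3 * x = x ^ 4" for x :: 'a by (simp add: eval_nat_numeral mult_ac)
  then have e: "qe (- int i) ^ 3 * qe (- int i) = qe (- 4 * int i)"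
    using power_int_mult[of q "- int i" 4] by (simp add: mult.commute)
  have "A * (z * G) ^ 3 * (C * z) = A * (z ^ 3 * z) * G ^ 3 * C" for A z G C :: 'a
    by (simp add: power_mult_distrib mult_ac)
  from this[of _ "qe (- int i)"]
  have "(1 - qe (4 * int i)) * (qe (- int i) * g (m - i)) ^ 3 * (c (m - i) * qe (- int i))
    = ((1 - qe (4 * int i)) * qe (- 4 * int i)) * g (m - i) ^ 3 * c (m - i)"
    unfolding e .
  also have "(1 - qe (4 * int i)) * qe (- 4 * int i) = - (1 - qe (- 4 * int i))"
    by (simp add: left_diff_distrib flip: qe_add)
  finally show ?thesis using add_V[OF p m] by (simp add: algebra_simps)
qed

text \<open>The weight is invariant under k to 2m - k, so adding the reversed sum makes the terms
  cancel in pairs.\<close>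

lemma sum_u_c_V1: "(\<Sum>k\<le>2 * m. u k * c k * of_nat (k * (2 * m - k))) \<in> V 1"
proof -
  let ?f = "\<lambda>k. u k * c k * of_nat (k * (2 * m - k))"
  have "sum ?f {..2 * m} = (\<Sum>k\<le>2 * m. ?f (2 * m - k))"
    using sum.atLeastAtMost_rev[of ?f 0 "2 * m"] by (simp add: atMost_atLeast0)
  then have "2 * sum ?f {..2 * m} = (\<Sum>k\<le>2 * m. ?f k + ?f (2 * m - k))"
    by (simp add: sum.distrib)
  also have "\<dots> \<in> V 1"
  proof (rule sum_V)
    fix k assume k: "k \<in> {..2 * m}"
    have "u k * c k + u (2 * m - k) * c (2 * m - k) \<in> V 1"
    proof (cases "k \<le> m")
      case True
      then have "m + (m - k) = 2 * m - k" "m - (m - k) = k" by auto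
      then show ?thesis using u_c_reflect[of "m - k"] by (simp add: add.commute)
    next
      case False
      then have "m + (k - m) = k" "m - (k - m) = 2 * m - k" "k - m \<le> m" using k by auto
      then show ?thesis using u_c_reflect[of "k - m"] by simp
    qed
    moreover have "?f k + ?f (2 * m - k)
      = (u k * c k + u (2 * m - k) * c (2 * m - k)) * of_nat (k * (2 * m - k))"
      using k by (simp add: algebra_simps)
    ultimately show "?f k + ?f (2 * m - k) \<in> V 1" by (simp only: mult_V_right of_nat_V0)
  qed
  finally have "inverse 2 * (2 * sum ?f {..2 * m}) \<in> V 1" using inverse_2_V0 by (rule mult_V_left[rotated])
  then show ?thesis using two_nonzero by (simp only: mult.assoc[symmetric]) simp
qed

section \<open>Assembling the congruence\<close>

lemma sum_V2: "(\<Sum>k\<le>2 * m. u k * (c k * (q ^ n) ^ h k)) \<in> V 2"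
proof -
  define v where "v k = (1 - qe (1 + 4 * int k)) * g k * g' k" for k
  define E where "E k = c k * (q ^ n) ^ h k" for k
  define A where "A k = R (2 * int m + 2) k + R (1 - 2 * int m) k" for k
  define x where "x = q ^ n - 1"
  define K where "K k = (of_nat (k * (2 * m - k)) :: 'a)" for k
  have xV: "x \<in> V 1" using uminus_V[OF one_minus_q_power_V1] by (simp add: x_def)
  have cV: "c k \<in> V 0" for k by (simp add: c_def)
  have EV: "E k \<in> V 0" for k unfolding E_def by (intro mult_V_left cV power_V0 q_V0)
  have vV: "v k \<in> V 0" and uv: "u k - v k \<in> V 2" if "k \<le> 2 * m" for k
  proof -
    show "v k \<in> V 0" unfolding v_def by (intro mult_V_left one_minus_qe_V0 g_V0 g'_V0_cong that)
    have "u k - v k = (1 - qe (1 + 4 * int k)) * g k * ((g k)\<^sup>2 - g' k)"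
      by (simp add: u_def v_def algebra_simps power2_eq_square power3_eq_cube)
    then show "u k - v k \<in> V 2"
      by (auto intro!: mult_V_left one_minus_qe_V0 g_V0 that cong_V_sym g'_V0_cong)
  qed
  have "(\<Sum>k\<le>2 * m. v k * R (2 * int m + 2) k) \<in> V 2"
    unfolding v_def
  proof (rule vwp_sum_V2[of m])
    show "int n dvd 1 - 4 * int m - (2 * int m + 2) + 2 * int m" by (rule dvdI[of _ _ "- 1"]) (simp add: n_eq)
  qed (use m_pos nd_A nz_A in auto)
  moreover have "(\<Sum>k\<le>2 * m. v k * R (1 - 2 * int m) k) \<in> V 2"
    unfolding v_def by (rule vwp_sum_V2[of m]) (use m_pos nd_B nz_B in auto)
  ultimately have 1: "(\<Sum>k\<le>2 * m. v k * A k) \<in> V 2"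
    unfolding A_def distrib_left sum.distrib by (rule add_V)
  have 2: "(\<Sum>k\<le>2 * m. (u k - v k) * (2 * E k)) \<in> V 2"
    by (intro sum_V mult_V_right uv mult_V_left numeral_V0 EV) auto
  have 3: "(\<Sum>k\<le>2 * m. v k * (2 * E k - A k - c k * x * K k)) \<in> V 2"
    using power_vs_average unfolding E_def A_def x_def K_def by (intro sum_V mult_V_left vV) auto
  have 4: "(\<Sum>k\<le>2 * m. (v k - u k) * (c k * x * K k)) \<in> V 2"
    unfolding K_def
    by (intro sum_V mult_V_right[OF cong_V_sym[OF uv]] mult_V_left cV V_subset[OF _ xV] of_nat_V0) auto
  have 5: "x * (\<Sum>k\<le>2 * m. u k * c k * K k) \<in> V 2"
    unfolding K_def using mult_V[OF xV sum_u_c_V1] by (simp add: numeral_2_eq_2)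
  \<comment> \<open>Pass from \<open>u\<close> to \<open>v\<close>, replace 2E by A + c x K, and
    return to \<open>u\<close> in the correction term, which leaves \<open>x\<close> times the
    antisymmetric sum.\<close>
  have "2 * (\<Sum>k\<le>2 * m. u k * E k) = (\<Sum>k\<le>2 * m. v k * A k) + (\<Sum>k\<le>2 * m. (u k - v k) * (2 * E k))
    + (\<Sum>k\<le>2 * m. v k * (2 * E k - A k - c k * x * K k)) + (\<Sum>k\<le>2 * m. (v k - u k) * (c k * x * K k))
    + x * (\<Sum>k\<le>2 * m. u k * c k * K k)"
    unfolding sum_distrib_left sum.distrib[symmetric] by (intro sum.cong refl) (simp add: algebra_simps)
  also have "\<dots> \<in> V 2" by (intro add_V 1 2 3 4 5)
  finally have "inverse 2 * (2 * (\<Sum>k\<le>2 * m. u k * E k)) \<in> V 2" using inverse_2_V0 by (rule mult_V_left[rotated])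
  then show ?thesis using two_nonzero unfolding E_def by (simp only: mult.assoc[symmetric]) simp
qed

lemma supercongruence:
  "(\<Sum>k = 0..(n - 1) div 2.
       qint q (4 * k + 1)
       * (qpoch q (q\<^sup>2) k ^ 3 / qpoch (q\<^sup>2) (q\<^sup>2) k ^ 3)
       * q powi ((int k * (int n ^ 2 - 2 * int n * int k - int n - 2)) div 4)) \<in> V 2"
proof -
  have summand: "qint q (4 * k + 1) * (qpoch q (q\<^sup>2) k ^ 3 / qpoch (q\<^sup>2) (q\<^sup>2) k ^ 3)
       * q powi ((int k * (int n ^ 2 - 2 * int n * int k - int n - 2)) div 4)
     = inverse (1 - q) * (u k * (c k * (q ^ n) ^ h k))" if k: "k \<le> 2 * m" for k
  proof -
    have "2 * int (h k) = int (2 * h k)" by simp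
    also have "\<dots> = int k * (2 * int m - int k) + int k"
      unfolding two_h[OF k] using k by (simp add: of_nat_diff)
    finally have h: "2 * int (h k) = int k * (2 * int m - int k) + int k" .
    \<comment> \<open>The exponent of the theorem is that of \<open>c k\<close> plus
      \<open>h k\<close> times \<open>n\<close>; checking this after multiplication by 4 shows that
      \<open>div\<close> is exact.\<close>
    have "4 * (- int k * (2 * int m + 1) + int n * int (h k)) = - 4 * int k * (2 * int m + 1) + 2 * int n * (2 * int (h k))"
      by (simp add: algebra_simps)
    also have "\<dots> = int k * (int n ^ 2 - 2 * int n * int k - int n - 2)"
      unfolding h by (simp add: n_eq algebra_simps power2_eq_square)
    finally have e: "(int k * (int n ^ 2 - 2 * int n * int k - int n - 2)) div 4
      = - int k * (2 * int m + 1) + int n * int (h k)"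
      by (metis nonzero_mult_div_cancel_left zero_neq_numeral)
    have "(q ^ n) ^ h k = qe (int n * int (h k))" using power_int_mult[of q "int n" "int (h k)"] by simp
    then have c: "c k * (q ^ n) ^ h k = qe (- int k * (2 * int m + 1) + int n * int (h k))"
      unfolding qe_add by (simp only: c_def)
    have "qpoch q (q\<^sup>2) k / qpoch (q\<^sup>2) (q\<^sup>2) k = g k"
      using qpoch_qe[of 1 k] qpoch_qe[of 2 k] power_int_of_nat[of q 2] by (simp add: g_def prod_dividef)
    then have gk: "qpoch q (q\<^sup>2) k ^ 3 / qpoch (q\<^sup>2) (q\<^sup>2) k ^ 3 = g k ^ 3"
      by (simp flip: power_divide)
    have "q ^ (4 * k + 1) = qe (1 + 4 * int k)"
      using power_int_of_nat[of q "4 * k + 1"] by (simp add: add.commute)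
    then show ?thesis
      unfolding e c gk u_def qint_def by (simp add: divide_inverse mult_ac)
  qed
  have N: "(n - 1) div 2 = 2 * m" by (simp add: n_eq)
  \<comment> \<open>The denominator of the q-integer is a unit because n > 1.\<close>
  have "inverse (1 - q) \<in> V 0" using inverse_one_minus_qe_V0[of 1] n_eq m_pos by simp
  from mult_V_left[OF this sum_V2] show ?thesis
    unfolding N atMost_atLeast0 sum_distrib_left
    by (rule back_subst[of "\<lambda>s. s \<in> V 2", OF _ sum.cong]) (simp_all only: summand atLeastAtMost_iff)
qed

end

subsection \<open>The local ring at a cyclotomic polynomial\<close>

lemma cis_root_power_eq_1_iff:
  assumes "n > 0"
  shows "cis (2 * pi / real n) ^ t = 1 \<longleftrightarrow> n dvd t"
proof
  let ?w = "cis (2 * pi / real n)"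
  have w: "?w ^ n = 1" using assms by (simp add: DeMoivre)
  then have "?w ^ t = ?w ^ (t mod n)"
    by (metis div_mult_mod_eq power_add power_mult mult.commute mult_1 power_one)
  moreover assume "?w ^ t = 1"
  moreover have "inj_on (\<lambda>k. ?w ^ k) {..<n}"
    using bij_betw_roots_unity[OF assms, THEN bij_betw_imp_inj_on]
    by (simp add: DeMoivre mult.commute divide_simps)
  ultimately have "t mod n = 0" using assms inj_onD[of "\<lambda>k. ?w ^ k" "{..<n}" "t mod n" 0] by simp
  then show "n dvd t" by auto
next
  assume "n dvd t"
  moreover have "cis (2 * pi / real n) ^ n = 1" using assms by (simp add: DeMoivre)
  ultimately show "cis (2 * pi / real n) ^ t = 1" by (auto simp: power_mult)
qed

lemma cyclotomic_complex_root:
  assumes "poly (cyclotomic_complex n) z = 0"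
  obtains k where "z = cis (2 * pi / real n) ^ k" "coprime k n"
  using assms by (auto simp: cyclotomic_complex_def poly_prod)

text \<open>A common divisor of positive degree would have a complex root, which would be a root of
  both polynomials.\<close>

lemma coprime_cyclotomicI:
  assumes "\<And>z. poly (cyclotomic_complex n) z = 0 \<Longrightarrow> poly (map_poly of_rat p) z \<noteq> 0"
  shows "coprime p (cyclotomic n)"
proof (rule coprimeI)
  fix d :: "rat poly" assume d: "d dvd p" "d dvd cyclotomic n"
  have root: "poly (map_poly of_rat r) z = 0" if "d dvd r" "poly (map_poly of_rat d) z = 0" for r and z :: complex
    using that by (auto simp: of_rat_poly_mult elim!: dvdE)
  have "cyclotomic_complex n \<noteq> 0" by (simp add: cyclotomic_complex_def)
  then have "cyclotomic n \<noteq> 0" using of_rat_cyclotomic[of n] by auto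
  then have "d \<noteq> 0" using d(2) by auto
  moreover have "degree d = 0"
  proof (rule ccontr)
    assume "degree d \<noteq> 0"
    then have "\<not> constant (poly (map_poly of_rat d :: complex poly))"
      by (simp add: constant_degree degree_map_poly)
    from fundamental_theorem_of_algebra[OF this] obtain z :: complex where z: "poly (map_poly of_rat d) z = 0" by blast
    then show False using assms[of z] root[OF d(1) z] root[OF d(2) z] by (simp add: of_rat_cyclotomic)
  qed
  ultimately show "is_unit d" by (simp add: is_unit_iff_degree)
qed

lemma map_poly_of_rat_one_minus_monom:
  "map_poly of_rat (1 - monom 1 j) = (1 - monom 1 j :: 'a::field_char_0 poly)"
  by (rule poly_eqI) (simp add: coeff_map_poly of_rat_diff)

text \<open>The roots are k-th powers of the standard n-th root of unity with k coprime to
  \<open>n\<close>; the j-th power of such a root is 1 only if \<open>n\<close> divides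
  \<open>j\<close>.\<close>

lemma coprime_one_minus_monom_cyclotomic:
  assumes "n > 0" "\<not> n dvd j"
  shows "coprime (1 - monom 1 j) (cyclotomic n)"
proof (rule coprime_cyclotomicI)
  fix z assume "poly (cyclotomic_complex n) z = 0"
  then obtain k where k: "z = cis (2 * pi / real n) ^ k" "coprime k n" by (rule cyclotomic_complex_root)
  have "\<not> n dvd k * j" using assms(2) k(2) by (simp add: coprime_dvd_mult_right_iff coprime_commute)
  then have "z ^ j \<noteq> 1" using cis_root_power_eq_1_iff[OF assms(1), of "k * j"] by (simp add: k(1) power_mult)
  then show "poly (map_poly of_rat (1 - monom 1 j)) z \<noteq> 0"
    by (simp add: map_poly_of_rat_one_minus_monom poly_monom)
qed

lemma coprime_X_cyclotomic: "coprime [:0, 1:] (cyclotomic n)"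
proof (rule coprime_cyclotomicI)
  fix z assume "poly (cyclotomic_complex n) z = 0"
  then obtain k where "z = cis (2 * pi / real n) ^ k" by (rule cyclotomic_complex_root)
  then show "poly (map_poly of_rat [:0, 1:]) z \<noteq> 0" by (simp add: map_poly_pCons)
qed

text \<open>The complex product formula over the divisors of \<open>n\<close> descends to rational
  coefficients because the embedding is injective on coefficients.\<close>

lemma cyclotomic_dvd:
  assumes "n > 0"
  shows "cyclotomic n dvd 1 - monom 1 n"
proof -
  let ?h = "map_poly of_rat :: rat poly \<Rightarrow> complex poly"
  have "?h (\<Prod>d | d dvd n. cyclotomic d) = - ?h (1 - monom 1 n)"
    using prod_cyclotomic_complex[OF assms]
    by (simp add: of_rat_poly_prod of_rat_cyclotomic map_poly_of_rat_one_minus_monom)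
  also have "\<dots> = ?h (- (1 - monom 1 n))"
    by (rule poly_eqI) (simp add: coeff_map_poly of_rat_diff of_rat_minus)
  finally have *: "?h (\<Prod>d | d dvd n. cyclotomic d) = ?h (- (1 - monom 1 n))" .
  have "(\<Prod>d | d dvd n. cyclotomic d) = - (1 - monom 1 n)"
  proof (rule poly_eqI)
    fix i show "coeff (\<Prod>d | d dvd n. cyclotomic d) i = coeff (- (1 - monom 1 n)) i"
      using arg_cong[OF *, of "\<lambda>p. coeff p i"] by (simp add: coeff_map_poly)
  qed
  moreover have "cyclotomic n dvd (\<Prod>d | d dvd n. cyclotomic d)"
    using assms by (intro dvd_prodI) auto
  ultimately show ?thesis by (simp only: dvd_minus_iff)
qed

section \<open>The filtration by powers of \<open>M\<close>\<close>

definition local_ideal :: "rat poly \<Rightarrow> nat \<Rightarrow> rat poly fract set" where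
  "local_ideal M i = {Fract (M ^ i * P) Q | P Q. Q \<noteq> 0 \<and> coprime Q M}"

lemma local_idealI: "Q \<noteq> 0 \<Longrightarrow> coprime Q M \<Longrightarrow> Fract (M ^ i * P) Q \<in> local_ideal M i"
  by (auto simp: local_ideal_def)

lemma local_idealE:
  assumes "x \<in> local_ideal M i"
  obtains P Q where "x = Fract (M ^ i * P) Q" "Q \<noteq> 0" "coprime Q M"
  using assms by (auto simp: local_ideal_def)

text \<open>Members of \<open>local_ideal\<close> need not be in lowest terms. The cancelled gcd
  divides \<open>Q\<close>, hence is coprime to \<open>M\<close>, so \<open>M ^ i\<close> survives
  in the numerator.\<close>

lemma ratfun_cong_0I:
  assumes "x \<in> local_ideal M i"
  shows "ratfun_cong_0 x (M ^ i)"
proof -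
  obtain P Q where x: "x = Fract (M ^ i * P) Q" "Q \<noteq> 0" "coprime Q M"
    using assms by (rule local_idealE)
  define d where "d = gcd (M ^ i * P) Q"
  have "d \<noteq> 0" using x(2) by (simp add: d_def)
  obtain A B where AB: "M ^ i * P = A * d" "Q = B * d" "coprime A B"
    using gcd_coprime_exists[of "M ^ i * P" Q] \<open>d \<noteq> 0\<close> unfolding d_def by blast
  have "B \<noteq> 0" using AB(2) x(2) by auto
  have "x = Fract A B" unfolding x(1) AB(1,2) using \<open>d \<noteq> 0\<close> \<open>B \<noteq> 0\<close> by (simp add: eq_fract)
  moreover have "coprime B M" "coprime d M" using x(3) AB(2) by auto
  moreover have "M ^ i dvd A * d" using AB(1) by (metis dvd_triv_left)
  ultimately show ?thesis
    unfolding ratfun_cong_0_def using AB(3) \<open>B \<noteq> 0\<close>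
    by (intro exI[of _ A] exI[of _ B]) (auto simp: coprime_dvd_mult_left_iff coprime_commute)
qed

lemma qvar_power: "qvar ^ j = Fract (monom 1 j) 1"
  by (induction j) (simp_all add: qvar_def One_fract_def monom_Suc monom_0 one_pCons)

lemma one_minus_qvar_power: "1 - qvar ^ j = Fract (1 - monom 1 j) 1"
  by (simp add: qvar_power One_fract_def)

lemma local_ideal_add:
  assumes "x \<in> local_ideal M i" "y \<in> local_ideal M i"
  shows "x + y \<in> local_ideal M i"
proof -
  obtain P Q where x: "x = Fract (M ^ i * P) Q" "Q \<noteq> 0" "coprime Q M" using assms(1) by (rule local_idealE)
  obtain P' Q' where y: "y = Fract (M ^ i * P') Q'" "Q' \<noteq> 0" "coprime Q' M" using assms(2) by (rule local_idealE)
  have "x + y = Fract (M ^ i * (P * Q' + P' * Q)) (Q * Q')" using x y by (simp add: algebra_simps)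
  then show ?thesis using local_idealI[of "Q * Q'" M i] x y by simp
qed

lemma local_ideal_mult:
  assumes "x \<in> local_ideal M i" "y \<in> local_ideal M j"
  shows "x * y \<in> local_ideal M (i + j)"
proof -
  obtain P Q where x: "x = Fract (M ^ i * P) Q" "Q \<noteq> 0" "coprime Q M" using assms(1) by (rule local_idealE)
  obtain P' Q' where y: "y = Fract (M ^ j * P') Q'" "Q' \<noteq> 0" "coprime Q' M" using assms(2) by (rule local_idealE)
  have "x * y = Fract (M ^ (i + j) * (P * P')) (Q * Q')" using x y by (simp add: power_add mult_ac)
  then show ?thesis using local_idealI[of "Q * Q'" M "i + j"] x y by simp
qed

lemma cyclotomic_filtration_local_ideal:
  assumes "n > 0"
  shows "cyclotomic_filtration qvar n (local_ideal (cyclotomic n))"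
proof
  let ?M = "cyclotomic n"
  have int: "Fract p 1 \<in> local_ideal ?M 0" for p
    using local_idealI[of 1 ?M 0 p] by simp
  show "0 \<in> local_ideal ?M i" for i
    using local_idealI[of 1 ?M i 0] by (simp add: Zero_fract_def)
  show "1 \<in> local_ideal ?M 0" using int[of 1] by (simp add: One_fract_def)
  show "- x \<in> local_ideal ?M i" if "x \<in> local_ideal ?M i" for x i
  proof -
    obtain P Q where "x = Fract (?M ^ i * P) Q" "Q \<noteq> 0" "coprime Q ?M" using \<open>x \<in> local_ideal ?M i\<close> by (rule local_idealE)
    then show ?thesis using local_idealI[of Q ?M i "- P"] by simp
  qed
  show "local_ideal ?M (Suc i) \<subseteq> local_ideal ?M i" for i
  proof
    fix x assume "x \<in> local_ideal ?M (Suc i)"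
    then obtain P Q where "x = Fract (?M ^ Suc i * P) Q" "Q \<noteq> 0" "coprime Q ?M" by (rule local_idealE)
    then show "x \<in> local_ideal ?M i" using local_idealI[of Q ?M i "?M * P"] by (simp add: mult_ac)
  qed
  show "qvar \<in> local_ideal ?M 0" unfolding qvar_def by (rule int)
  show "inverse qvar \<in> local_ideal ?M 0"
    using local_idealI[of "[:0, 1:]" ?M 0 1] coprime_X_cyclotomic by (simp add: qvar_def)
  show "qvar \<noteq> 0" by (simp add: qvar_def Zero_fract_def eq_fract)
  show "qvar ^ j \<noteq> 1" if "j > 0" for j
  proof -
    have "monom 1 j \<noteq> (1 :: rat poly)" using that by (metis degree_1 degree_monom_eq less_irrefl zero_neq_one)
    then show ?thesis by (simp add: qvar_power One_fract_def eq_fract)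
  qed
  show "1 - qvar ^ n \<in> local_ideal ?M 1"
  proof -
    obtain P where "1 - monom 1 n = ?M * P" using cyclotomic_dvd[OF assms] by (elim dvdE)
    then show ?thesis using local_idealI[of 1 ?M 1 P] by (simp add: one_minus_qvar_power)
  qed
  show "inverse (1 - qvar ^ j) \<in> local_ideal ?M 0" if "\<not> n dvd j" for j
  proof -
    note c = coprime_one_minus_monom_cyclotomic[OF assms that]
    have "1 - monom 1 j \<noteq> (0 :: rat poly)"
    proof
      assume "1 - monom 1 j = (0 :: rat poly)"
      then have "monom 1 j = (1 :: rat poly)" by simp
      then have "j = 0" by (metis degree_1 degree_monom_eq zero_neq_one)
      then show False using that by simp
    qed
    then show ?thesis using local_idealI[OF _ c, of 0 1] by (simp add: one_minus_qvar_power)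
  qed
qed (fact local_ideal_add local_ideal_mult)+

lemma inverse_two_fract: "inverse 2 = (Fract [:1 / 2:] 1 :: rat poly fract)" and two_fract_nonzero: "(2 :: rat poly fract) \<noteq> 0"
proof -
  have "2 * (Fract [:1 / 2:] 1 :: rat poly fract) = 1"
    unfolding mult_2 by (simp add: One_fract_def one_pCons)
  then show "(2 :: rat poly fract) \<noteq> 0" "inverse 2 = (Fract [:1 / 2:] 1 :: rat poly fract)"
    by (auto intro: inverse_unique)
qed

theorem theorem1:
  fixes n :: nat
  assumes "n > 1" and "[n = 1] (mod 4)"
  shows "ratfun_cong_0
    (\<Sum>k = 0..(n - 1) div 2.
       qint qvar (4 * k + 1)
       * (qpoch qvar (qvar\<^sup>2) k ^ 3 / qpoch (qvar\<^sup>2) (qvar\<^sup>2) k ^ 3)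
       * qvar powi ((int k * (int n ^ 2 - 2 * int n * int k - int n - 2)) div 4))
    (cyclotomic n ^ 2)"
proof -
  define m where "m = n div 4"
  have n: "n = 4 * m + 1"
    using assms(2) div_mult_mod_eq[of n 4] by (simp add: m_def cong_def)
  interpret cyclotomic_filtration qvar n "local_ideal (cyclotomic n)"
    using assms(1) by (intro cyclotomic_filtration_local_ideal) simp
  interpret cyclotomic_filtration_1_mod_4 qvar n "local_ideal (cyclotomic n)" m
  proof
    show "inverse 2 \<in> local_ideal (cyclotomic n) 0"
      unfolding inverse_two_fract using local_idealI[of 1 "cyclotomic n" 0 "[:1 / 2:]"] by simp
  qed (use assms(1) n two_fract_nonzero in auto)
  show ?thesis by (rule ratfun_cong_0I[OF supercongruence])
qed

end
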